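(* There is a random-preserving partial computable left-oneway function $f:\subseteq\{0,1\}^\omega\to\{0,1\}^\omega$ which is not right-oneway.
   Context: Reals are elements of $\{0,1\}^\omega$ and $\mu$ is the uniform measure. For reals $x,y$, $x\oplus y$ is the real $z$ with $z(2n)=x(n)$, $z(2n+1)=y(n)$. A partial function $f:\subseteq\{0,1\}^\omega\to\{0,1\}^\omega$ is partial computable if there is an oracle Turing functional $\Phi$ such that for every $x$: $x\in\mathrm{dom}(f)$ iff $\Phi^x(n)\downarrow$ for all $n$; and if $x\in\mathrm{dom}(f)$ then $\Phi^x(n)=f(x)(n)$ for all $n$. Random means Martin-Löf random. $f$ is random-preserving if $\mu(\mathrm{dom}(f))>0$ and $f(x)$ is random for each random $x\in\mathrm{dom}(f)$. A partial computable $f$ is left-oneway if $\mu(\mathrm{dom}(f))>0$ and $\mu(\{x\oplus r: f(g(f(x)\oplus r))=f(x)\})=0$ for each partial computable $g$. It is right-oneway if $\mu(f(\{0,1\}^\omega))>0$ and $\mu(\{y\oplus r: f(g(y\oplus r))=y\})=0$ for each partial computable $g$. Here $f(\{0,1\}^\omega)$ is the range of $f$, and equations include the assertion that all terms are defined. *)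

theory Defs
  imports "HOL-Probability.Probability" "HOL-Library.Nat_Bijection"
begin

type_synonym bitseq = "nat \<Rightarrow> bool"

text \<open>
  The completion is needed for ranges of partial computable maps: these are analytic sets, hence
  measurable for the completed measure, but in general not Borel. Every other set measured below
  is Borel.
\<close>

definition cantor_measure :: "bitseq measure" where
  "cantor_measure = completion (\<Pi>\<^sub>M i\<in>UNIV. measure_pmf (bernoulli_pmf (1/2)))"

definition join :: "bitseq \<Rightarrow> bitseq \<Rightarrow> bitseq"  (infixl "\<oplus>" 65) where
  "x \<oplus> y = (\<lambda>k. if even k then x (k div 2) else y (k div 2))"

text \<open>
  Turing functionals are presented as Kleene's partial recursive functionals: programs are terms
  over the usual initial functions, composition, primitive recursion and minimisation, together
  with a constructor that queries the oracle. \<open>eval A p xs v\<close> means that program \<open>p\<close> with oracle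
  \<open>A\<close> halts on the argument list \<open>xs\<close> with value \<open>v\<close>.
\<close>

datatype prog =
    Zero
  | Succ
  | Proj nat
  | Query
  | Comp prog "prog list"
  | PrimRec prog prog
  | Mu prog

inductive eval :: "bitseq \<Rightarrow> prog \<Rightarrow> nat list \<Rightarrow> nat \<Rightarrow> bool" for A :: bitseq where
  Zero: "eval A Zero xs 0"
| Succ: "eval A Succ [n] (Suc n)"
| Proj: "i < length xs \<Longrightarrow> eval A (Proj i) xs (xs ! i)"
| Query: "eval A Query [n] (of_bool (A n))"
| Comp: "list_all2 (\<lambda>g u. eval A g xs u) gs us \<Longrightarrow> eval A f us v \<Longrightarrow> eval A (Comp f gs) xs v"
| PrimRec_0: "eval A f xs v \<Longrightarrow> eval A (PrimRec f g) (0 # xs) v"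
| PrimRec_Suc: "eval A (PrimRec f g) (n # xs) u \<Longrightarrow> eval A g (n # u # xs) v \<Longrightarrow>
    eval A (PrimRec f g) (Suc n # xs) v"
| Mu: "eval A f (n # xs) 0 \<Longrightarrow> (\<forall>m<n. \<exists>k. eval A f (m # xs) (Suc k)) \<Longrightarrow> eval A (Mu f) xs n"

definition halts :: "bitseq \<Rightarrow> prog \<Rightarrow> nat list \<Rightarrow> bool" where
  "halts A p xs \<longleftrightarrow> (\<exists>v. eval A p xs v)"

inductive_cases eval_ZeroE: "eval A Zero xs v"
inductive_cases eval_SuccE: "eval A Succ xs v"
inductive_cases eval_ProjE: "eval A (Proj i) xs v"
inductive_cases eval_QueryE: "eval A Query xs v"
inductive_cases eval_CompE: "eval A (Comp f gs) xs v"
inductive_cases eval_PrimRec_0E: "eval A (PrimRec f g) (0 # xs) v"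
inductive_cases eval_PrimRec_SucE: "eval A (PrimRec f g) (Suc n # xs) v"
inductive_cases eval_MuE: "eval A (Mu f) xs v"

lemma eval_deterministic: "eval A p xs v \<Longrightarrow> eval A p xs w \<Longrightarrow> v = w"
proof (induction arbitrary: w rule: eval.induct)
  case (Zero xs)
  then show ?case by (rule eval_ZeroE) simp
next
  case (Succ n)
  then show ?case by (rule eval_SuccE) simp
next
  case (Proj i xs)
  from Proj.prems show ?case by (rule eval_ProjE) simp
next
  case (Query n)
  then show ?case by (rule eval_QueryE) simp
next
  case (Comp xs gs us f v)
  from Comp.prems obtain us' where us': "list_all2 (\<lambda>g u. eval A g xs u) gs us'" "eval A f us' w"
    by (rule eval_CompE)
  have "us = us'"
  proof (rule nth_equalityI)
    show "length us = length us'"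
      using list_all2_lengthD[OF Comp.IH(1)] list_all2_lengthD[OF us'(1)] by simp
  next
    fix i assume "i < length us"
    then have i: "i < length gs" using list_all2_lengthD[OF Comp.IH(1)] by simp
    show "us ! i = us' ! i"
      using list_all2_nthD[OF Comp.IH(1) i] list_all2_nthD[OF us'(1) i] by blast
  qed
  then show ?case using Comp.IH(2) us'(2) by simp
next
  case (PrimRec_0 f xs v g)
  from PrimRec_0.prems show ?case by (rule eval_PrimRec_0E) (rule PrimRec_0.IH)
next
  case (PrimRec_Suc f g n xs u v)
  from PrimRec_Suc.prems obtain u' where
    "eval A (PrimRec f g) (n # xs) u'" "eval A g (n # u' # xs) w"
    by (rule eval_PrimRec_SucE)
  then show ?case using PrimRec_Suc.IH by blast
next
  case (Mu f n xs)
  from Mu.prems have w: "eval A f (w # xs) 0" "\<forall>m<w. \<exists>k. eval A f (m # xs) (Suc k)"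
    by - (erule eval_MuE, assumption)+
  show ?case
  proof (rule linorder_cases[of n w])
    assume "n < w"
    then show ?thesis using w(2) Mu.IH(1) by (blast dest: Zero_neq_Suc)
  next
    assume "w < n"
    then show ?thesis using w(1) Mu.IH(2) by (blast dest: Suc_neq_Zero)
  qed
qed

definition computes :: "prog \<Rightarrow> (bitseq \<rightharpoonup> bitseq) \<Rightarrow> bool" where
  "computes p f \<longleftrightarrow>
     (\<forall>x. x \<in> dom f \<longleftrightarrow> (\<forall>n. halts x p [n])) \<and>
     (\<forall>x y. f x = Some y \<longrightarrow> (\<forall>n. eval x p [n] (of_bool (y n))))"

definition partial_computable :: "(bitseq \<rightharpoonup> bitseq) \<Rightarrow> bool" where
  "partial_computable f \<longleftrightarrow> (\<exists>p. computes p f)"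

text \<open>
  A uniformly c.e. sequence of sets of strings is given as a c.e. set of pairs \<open>(n, \<sigma>)\<close>, that is,
  the halting set of a program run with the computable oracle \<open>\<lambda>_. False\<close>.
\<close>

definition uniformly_ce :: "(nat \<Rightarrow> bool list set) \<Rightarrow> bool" where
  "uniformly_ce W \<longleftrightarrow>
     (\<exists>p. \<forall>n \<sigma>. \<sigma> \<in> W n \<longleftrightarrow> halts (\<lambda>_. False) p [n, list_encode (map of_bool \<sigma>)])"

definition cylinders :: "bool list set \<Rightarrow> bitseq set" where
  "cylinders S = {x. \<exists>\<sigma>\<in>S. \<forall>i<length \<sigma>. x i = \<sigma> ! i}"

definition ml_test :: "(nat \<Rightarrow> bool list set) \<Rightarrow> bool" where
  "ml_test W \<longleftrightarrow> uniformly_ce W \<and> (\<forall>n. measure cantor_measure (cylinders (W n)) \<le> (1/2) ^ n)"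

definition ml_random :: "bitseq \<Rightarrow> bool" where
  "ml_random x \<longleftrightarrow> (\<forall>W. ml_test W \<longrightarrow> x \<notin> (\<Inter>n. cylinders (W n)))"

definition random_preserving :: "(bitseq \<rightharpoonup> bitseq) \<Rightarrow> bool" where
  "random_preserving f \<longleftrightarrow>
     measure cantor_measure (dom f) > 0 \<and>
     (\<forall>x y. ml_random x \<longrightarrow> f x = Some y \<longrightarrow> ml_random y)"

definition left_oneway :: "(bitseq \<rightharpoonup> bitseq) \<Rightarrow> bool" where
  "left_oneway f \<longleftrightarrow>
     partial_computable f \<and>
     measure cantor_measure (dom f) > 0 \<and>
     (\<forall>g. partial_computable g \<longrightarrow>
        measure cantor_measure
          {x \<oplus> r | x r. \<exists>y z. f x = Some y \<and> g (y \<oplus> r) = Some z \<and> f z = Some y} = 0)"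

definition right_oneway :: "(bitseq \<rightharpoonup> bitseq) \<Rightarrow> bool" where
  "right_oneway f \<longleftrightarrow>
     partial_computable f \<and>
     measure cantor_measure (ran f) > 0 \<and>
     (\<forall>g. partial_computable g \<longrightarrow>
        measure cantor_measure
          {y \<oplus> r | y r. \<exists>z. g (y \<oplus> r) = Some z \<and> f z = Some y} = 0)"

end

theory Submission
  imports Defs
begin

text \<open>
  The witness \<open>scramble\<close> copies bits: if the first bit of \<open>x\<close> is \<open>False\<close>, then the \<open>n\<close>-th bit of
  \<open>scramble x\<close> is \<open>x (source n)\<close> for a computable injection \<open>source\<close>; if the first bit is \<open>True\<close>,
  then \<open>scramble x\<close> consists of the bits of \<open>x\<close> at even positions, and it is defined only if all
  bits at odd positions are \<open>True\<close>. The reals \<open>x\<close> of the second kind in the domain form a null set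
  without random elements, so they matter neither for preservation of randomness nor for
  left-onewayness. But their images are all reals that start with \<open>True\<close>, a set of measure
  \<open>1/2\<close>, and a preimage is found by inserting \<open>True\<close> at the odd positions. Hence \<open>scramble\<close> is not
  right-oneway.

  On the reals of the first kind, \<open>scramble\<close> permutes and forgets fair coin tosses, so it preserves
  the measure, and the preimage of a Martin-Loef test is again such a test (\<open>ml_random_source\<close>).
  A program \<open>p\<close> that inverts it on \<open>y \<oplus> r\<close> has to output the bit \<open>y s\<close> on input
  \<open>source s\<close>. It would have to know, for a given \<open>n\<close>, whether \<open>n\<close> is in the range of \<open>source\<close> and at
  which place, for otherwise it cannot do better than guess. The function \<open>source\<close> is built so as
  to exploit this: for every \<open>p\<close> and every cylinder \<open>C\<close> of oracles a number \<open>n\<close> is reserved and kept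
  out of the range of \<open>source\<close> until at some time \<open>t\<close> the program \<open>p\<close> has halted on input \<open>n\<close> for
  more than \<open>3/4\<close> of the oracles in \<open>C\<close>, having read only their first \<open>t\<close> bits. Then \<open>source s = n\<close> is declared for an \<open>s\<close> so
  large that the bit \<open>y s\<close> has not been read. This bit is independent of what \<open>p\<close> has answered,
  so \<open>p\<close> fails on half of these oracles, and the oracles in \<open>C\<close> on which \<open>p\<close> always answers
  correctly have density at most \<open>5/8\<close>. If the set of all oracles on which \<open>p\<close> always answers
  correctly had positive measure, it would have density above \<open>3/4\<close> in some cylinder
  (\<open>exists_dense_cylinder\<close>). So it is null (\<open>measure_guessed\<close>).

  That \<open>source\<close> is computable needs an interpreter for oracle programs among the programs. It is a
  stack machine whose states are numbers and whose transition function is primitive recursive;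
  \<open>eval_run\<close> says that it simulates every halting computation. As the machine is deterministic, the
  state in which it halts thereby determines the value of the program.
\<close>

section \<open>Computable total functions\<close>

text \<open>
  Functions of several arguments serve to show that the pairing function and its inverses are
  computable. After that, \<open>computable\<close> takes over.
\<close>

definition computable_n :: "nat \<Rightarrow> (bitseq \<Rightarrow> nat list \<Rightarrow> nat) \<Rightarrow> bool" where
  "computable_n k F \<longleftrightarrow> (\<exists>p. \<forall>A xs. length xs = k \<longrightarrow> eval A p xs (F A xs))"

abbreviation computable1 :: "(nat \<Rightarrow> nat) \<Rightarrow> bool" where
  "computable1 f \<equiv> computable_n 1 (\<lambda>_ xs. f (xs ! 0))"

abbreviation computable2 :: "(nat \<Rightarrow> nat \<Rightarrow> nat) \<Rightarrow> bool" where
  "computable2 f \<equiv> computable_n 2 (\<lambda>_ xs. f (xs ! 0) (xs ! 1))"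

lemma computable_n_cong:
  assumes "computable_n k F" "\<And>A xs. length xs = k \<Longrightarrow> F A xs = G A xs"
  shows "computable_n k G"
  using assms unfolding computable_n_def by metis

lemma computable_n_nth: "i < k \<Longrightarrow> computable_n k (\<lambda>_ xs. xs ! i)"
  unfolding computable_n_def by (metis eval.Proj)

lemma computable_n_comp:
  assumes f: "computable_n (length Gs) F" and G: "\<And>G. G \<in> set Gs \<Longrightarrow> computable_n k G"
  shows "computable_n k (\<lambda>A xs. F A (map (\<lambda>G. G A xs) Gs))"
proof -
  from f obtain p where p: "\<And>A xs. length xs = length Gs \<Longrightarrow> eval A p xs (F A xs)"
    unfolding computable_n_def by blast
  from G have "\<forall>G\<in>set Gs. \<exists>q. \<forall>A xs. length xs = k \<longrightarrow> eval A q xs (G A xs)"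
    unfolding computable_n_def by blast
  then obtain q where q: "\<And>G A xs. G \<in> set Gs \<Longrightarrow> length xs = k \<Longrightarrow> eval A (q G) xs (G A xs)"
    by metis
  have "eval A (Comp p (map q Gs)) xs (F A (map (\<lambda>G. G A xs) Gs))" if "length xs = k" for A xs
  proof (rule eval.Comp)
    show "list_all2 (\<lambda>g u. eval A g xs u) (map q Gs) (map (\<lambda>G. G A xs) Gs)"
      using q that by (auto simp: list_all2_conv_all_nth)
    show "eval A p (map (\<lambda>G. G A xs) Gs) (F A (map (\<lambda>G. G A xs) Gs))"
      by (rule p) simp
  qed
  then show ?thesis unfolding computable_n_def by blast
qed

lemma computable_n_op1:
  "computable1 f \<Longrightarrow> computable_n k a \<Longrightarrow> computable_n k (\<lambda>A xs. f (a A xs))"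
  using computable_n_comp[of "[a]" "\<lambda>_ xs. f (xs ! 0)" k] by simp

lemma computable_n_op2:
  "computable2 f \<Longrightarrow> computable_n k a \<Longrightarrow> computable_n k b \<Longrightarrow>
    computable_n k (\<lambda>A xs. f (a A xs) (b A xs))"
  using computable_n_comp[of "[a, b]" "\<lambda>_ xs. f (xs ! 0) (xs ! 1)" k]
  by (auto simp: numeral_2_eq_2)

lemma computable_n_rec:
  assumes "computable_n k a" and "computable_n (Suc (Suc k)) G"
  shows "computable_n (Suc k)
    (\<lambda>A xs. rec_nat (a A (tl xs)) (\<lambda>m u. G A (m # u # tl xs)) (xs ! 0))"
proof -
  from assms obtain p q where p: "\<And>A xs. length xs = k \<Longrightarrow> eval A p xs (a A xs)"
    and q: "\<And>A xs. length xs = Suc (Suc k) \<Longrightarrow> eval A q xs (G A xs)"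
    unfolding computable_n_def by blast
  have "eval A (PrimRec p q) (n # xs) (rec_nat (a A xs) (\<lambda>m u. G A (m # u # xs)) n)"
    if "length xs = k" for A n xs
  proof (induction n)
    case 0
    then show ?case using p that by (auto intro: eval.PrimRec_0)
  next
    case (Suc n)
    then show ?case using q that by (auto intro!: eval.PrimRec_Suc)
  qed
  then have "eval A (PrimRec p q) xs
      (rec_nat (a A (tl xs)) (\<lambda>m u. G A (m # u # tl xs)) (xs ! 0))"
    if "length xs = Suc k" for A xs
    using that by (cases xs) auto
  then show ?thesis unfolding computable_n_def by blast
qed

lemma computable1_Suc: "computable1 Suc"
proof -
  have "eval A Succ xs (Suc (xs ! 0))" if "length xs = 1" for A xs
    using that eval.Succ[of A "xs ! 0"] by (cases xs) auto
  then show ?thesis unfolding computable_n_def by blast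
qed

lemma computable_n_const: "computable_n k (\<lambda>_ _. c)"
proof (induction c)
  case 0
  then show ?case unfolding computable_n_def by (metis eval.Zero)
next
  case (Suc c)
  show ?case by (rule computable_n_op1[OF computable1_Suc Suc])
qed

lemmas computable_n_base = computable_n_nth computable_n_const computable_n_op1[OF computable1_Suc]

lemma computable2_rec:
  assumes "computable1 a" and "computable_n 3 (\<lambda>_ xs. G (xs ! 0) (xs ! 1) (xs ! 2))"
  shows "computable2 (\<lambda>n x. rec_nat (a x) (\<lambda>m u. G m u x) n)"
proof -
  have "computable_n 2 (\<lambda>A xs. rec_nat (a (tl xs ! 0)) (\<lambda>m u. G ((m # u # tl xs) ! 0)
    ((m # u # tl xs) ! 1) ((m # u # tl xs) ! 2)) (xs ! 0))"
    using computable_n_rec[OF assms[unfolded numeral_3_eq_3 One_nat_def]]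
    by (simp add: numeral_2_eq_2)
  then show ?thesis
    by (rule computable_n_cong) (auto simp: nth_tl)
qed

lemma computable1_rec:
  assumes "computable2 G"
  shows "computable1 (\<lambda>n. rec_nat a G n)"
  using computable_n_rec[OF computable_n_const[of 0 a], of "\<lambda>_ xs. G (xs ! 0) (xs ! 1)"] assms
  by (simp add: numeral_2_eq_2)

lemma computable1_eq: "computable1 f \<Longrightarrow> (\<And>x. f x = g x) \<Longrightarrow> computable1 g"
  by (erule computable_n_cong) simp

lemma computable2_eq: "computable2 f \<Longrightarrow> (\<And>x y. f x y = g x y) \<Longrightarrow> computable2 g"
  by (erule computable_n_cong) simp

lemma computable2_swap: "computable2 f \<Longrightarrow> computable2 (\<lambda>x y. f y x)"
  by (rule computable_n_op2) (auto intro: computable_n_nth)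

lemma computable2_add: "computable2 (+)"
proof -
  have "computable2 (\<lambda>n x. rec_nat x (\<lambda>m u. Suc u) n)"
    by (rule computable2_rec) (intro computable_n_base; simp)+
  then show ?thesis
  proof (rule computable2_eq)
    show "rec_nat y (\<lambda>m. Suc) x = x + y" for x y :: nat by (induction x) auto
  qed
qed

lemma computable1_pred: "computable1 (\<lambda>x. x - 1)"
proof -
  have "computable1 (\<lambda>n. rec_nat 0 (\<lambda>m u. m) n)"
    by (rule computable1_rec) (intro computable_n_base; simp)
  then show ?thesis
  proof (rule computable1_eq)
    show "rec_nat 0 (\<lambda>m u. m) x = x - 1" for x :: nat by (cases x) auto
  qed
qed

lemma computable2_diff: "computable2 (-)"
proof -
  have "computable2 (\<lambda>n x. rec_nat x (\<lambda>m u. u - 1) n)"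
    by (rule computable2_rec) (intro computable_n_base computable_n_op1[OF computable1_pred]; simp)+
  then have "computable2 (\<lambda>n x. x - n)"
  proof (rule computable2_eq)
    show "rec_nat y (\<lambda>m u. u - 1) x = y - x" for x y :: nat by (induction x) auto
  qed
  then show ?thesis by (rule computable2_swap)
qed

lemma computable2_mult: "computable2 (*)"
proof -
  have "computable2 (\<lambda>n x. rec_nat 0 (\<lambda>m u. u + x) n)"
    by (rule computable2_rec) (intro computable_n_base computable_n_op2[OF computable2_add]; simp)+
  then show ?thesis
  proof (rule computable2_eq)
    show "rec_nat 0 (\<lambda>m u. u + y) x = x * y" for x y :: nat by (induction x) auto
  qed
qed

lemma computable1_triangle: "computable1 triangle"
proof -
  have "computable1 (\<lambda>n. rec_nat 0 (\<lambda>m u. u + Suc m) n)"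
    by (rule computable1_rec) (intro computable_n_base computable_n_op2[OF computable2_add]; simp)
  then show ?thesis
  proof (rule computable1_eq)
    show "rec_nat 0 (\<lambda>m u. u + Suc m) x = triangle x" for x :: nat by (induction x) auto
  qed
qed

lemma computable2_prod_encode: "computable2 (\<lambda>x y. prod_encode (x, y))"
  unfolding prod_encode_def prod.case
  by (intro computable_n_base computable_n_op2[OF computable2_add] computable_n_op1[OF computable1_triangle]; simp)

text \<open>
  The largest \<open>k\<close> with \<open>triangle k \<le> z\<close>. For \<open>z = prod_encode (x, y)\<close> it is \<open>x + y\<close>, which turns
  the search in \<open>prod_decode\<close> into arithmetic.
\<close>

definition triangle_root :: "nat \<Rightarrow> nat" where
  "triangle_root = rec_nat 0 (\<lambda>m u. u + (1 - (triangle (Suc u) - Suc m)))"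

lemma triangle_root_bounds:
  "triangle (triangle_root z) \<le> z \<and> z < triangle (Suc (triangle_root z))"
proof (induction z)
  case 0
  then show ?case by (simp add: triangle_root_def)
next
  case (Suc z)
  have "triangle_root (Suc z) =
      (if triangle (Suc (triangle_root z)) \<le> Suc z then Suc (triangle_root z) else triangle_root z)"
    by (simp add: triangle_root_def)
  with Suc show ?case by simp
qed

lemma triangle_mono: "m \<le> n \<Longrightarrow> triangle m \<le> triangle n"
  by (induction n rule: dec_induct) auto

lemma triangle_root_prod_encode: "triangle_root (prod_encode (x, y)) = x + y"
proof -
  let ?z = "prod_encode (x, y)"
  have b: "triangle (x + y) \<le> ?z" "?z < triangle (Suc (x + y))"
    by (auto simp: prod_encode_def)
  note r = triangle_root_bounds[of ?z]
  have "\<not> triangle_root ?z < x + y"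
    using triangle_mono[of "Suc (triangle_root ?z)" "x + y"] r b by linarith
  moreover have "\<not> x + y < triangle_root ?z"
    using triangle_mono[of "Suc (x + y)" "triangle_root ?z"] r b by linarith
  ultimately show ?thesis by simp
qed

lemma computable1_triangle_root: "computable1 triangle_root"
  unfolding triangle_root_def
  by (rule computable1_rec)
    (intro computable_n_base computable_n_op2[OF computable2_add] computable_n_op2[OF computable2_diff]
      computable_n_op1[OF computable1_triangle]; simp)

lemma fst_prod_decode: "fst (prod_decode z) = z - triangle (triangle_root z)"
  and snd_prod_decode: "snd (prod_decode z) = triangle_root z - (z - triangle (triangle_root z))"
proof -
  obtain x y where z: "z = prod_encode (x, y)"
    by (metis prod_decode_inverse surj_pair)
  have "z - triangle (triangle_root z) = x"
    unfolding z triangle_root_prod_encode by (simp add: prod_encode_def)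
  then show "fst (prod_decode z) = z - triangle (triangle_root z)"
    "snd (prod_decode z) = triangle_root z - (z - triangle (triangle_root z))"
    by (simp_all add: z triangle_root_prod_encode)
qed

lemma computable1_fst: "computable1 (\<lambda>z. fst (prod_decode z))"
  and computable1_snd: "computable1 (\<lambda>z. snd (prod_decode z))"
  unfolding fst_prod_decode snd_prod_decode
  by (intro computable_n_base computable_n_op2[OF computable2_diff]
    computable_n_op1[OF computable1_triangle] computable_n_op1[OF computable1_triangle_root]; simp)+

text \<open>
  Functions of one argument. A term with more variables is handled by packing them into one number,
  so the rules for operators that bind variables ask for the computability of the body with its
  variables replaced by projections. In this form the rules apply to terms with arbitrarily nested
  binders.
\<close>

definition computable :: "(bitseq \<Rightarrow> nat \<Rightarrow> nat) \<Rightarrow> bool" where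
  "computable F \<longleftrightarrow> computable_n 1 (\<lambda>A xs. F A (xs ! 0))"

lemma computableE:
  assumes "computable F"
  obtains p where "\<And>A x. eval A p [x] (F A x)"
proof -
  from assms obtain p where p: "\<And>A xs. length xs = 1 \<longrightarrow> eval A p xs (F A (xs ! 0))"
    unfolding computable_def computable_n_def by blast
  have "eval A p [x] (F A x)" for A x using p[of "[x]" A] by simp
  then show ?thesis by (rule that)
qed

lemma computable_id: "computable (\<lambda>_ x. x)"
  unfolding computable_def by (rule computable_n_nth) simp

lemma computable_const: "computable (\<lambda>_ _. c)"
  unfolding computable_def by (rule computable_n_const)

lemma computable_comp: "computable F \<Longrightarrow> computable a \<Longrightarrow> computable (\<lambda>A x. F A (a A x))"
  unfolding computable_def
  using computable_n_comp[of "[\<lambda>A xs. a A (xs ! 0)]" "\<lambda>A xs. F A (xs ! 0)" 1] by simp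

lemma computable_oracle: "computable (\<lambda>A x. of_bool (A x))"
proof -
  have "eval A Query xs (of_bool (A (xs ! 0)))" if "length xs = 1" for A xs
    using that eval.Query[of A "xs ! 0"] by (cases xs) auto
  then show ?thesis unfolding computable_def computable_n_def by blast
qed

lemma computable_op1: "computable1 f \<Longrightarrow> computable a \<Longrightarrow> computable (\<lambda>A x. f (a A x))"
  unfolding computable_def by (rule computable_n_op1)

lemma computable_op2:
  "computable2 f \<Longrightarrow> computable a \<Longrightarrow> computable b \<Longrightarrow> computable (\<lambda>A x. f (a A x) (b A x))"
  unfolding computable_def by (rule computable_n_op2)

named_theorems computable_intros

lemmas [computable_intros] = computable_id computable_const
  computable_comp[OF computable_oracle]
  computable_op1[OF computable1_Suc]
  computable_op1[OF computable1_fst] computable_op1[OF computable1_snd]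
  computable_op2[OF computable2_add] computable_op2[OF computable2_diff]
  computable_op2[OF computable2_mult] computable_op2[OF computable2_prod_encode]

lemma computable_rec [computable_intros]:
  assumes a: "computable a" and n: "computable n"
    and G: "computable (\<lambda>A y. G A (fst (prod_decode y)) (fst (prod_decode (snd (prod_decode y))))
      (snd (prod_decode (snd (prod_decode y)))))"
  shows "computable (\<lambda>A x. rec_nat (a A x) (\<lambda>m u. G A m u x) (n A x))"
proof -
  let ?H = "\<lambda>A y. G A (fst (prod_decode y)) (fst (prod_decode (snd (prod_decode y))))
      (snd (prod_decode (snd (prod_decode y))))"
  have "computable_n 3 (\<lambda>A xs. prod_encode (xs ! 0, prod_encode (xs ! 1, xs ! 2)))"
    by (intro computable_n_base computable_n_op2[OF computable2_prod_encode]) simp_all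
  then have "computable_n (Suc (Suc 1)) (\<lambda>A xs. G A (xs ! 0) (xs ! 1) (xs ! 2))"
    using computable_n_comp[of "[\<lambda>A xs. prod_encode (xs ! 0, prod_encode (xs ! 1, xs ! 2))]"
      "\<lambda>A xs. ?H A (xs ! 0)" 3] G[unfolded computable_def]
    by (simp add: numeral_3_eq_3 numeral_2_eq_2)
  from computable_n_rec[OF a[unfolded computable_def] this]
  have "computable_n (Suc (Suc 0)) (\<lambda>A xs. rec_nat (a A (tl xs ! 0)) (\<lambda>m u. G A m u (tl xs ! 0)) (xs ! 0))"
    by (simp add: numeral_2_eq_2)
  then have "computable_n (Suc (Suc 0)) (\<lambda>A xs. rec_nat (a A (xs ! 1)) (\<lambda>m u. G A m u (xs ! 1)) (xs ! 0))"
    by (rule computable_n_cong) (auto simp: nth_tl)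
  then show ?thesis
    using computable_n_comp[of "[\<lambda>A xs. n A (xs ! 0), \<lambda>A xs. xs ! 0]"
      "\<lambda>A xs. rec_nat (a A (xs ! 1)) (\<lambda>m u. G A m u (xs ! 1)) (xs ! 0)" 1]
      n computable_id
    unfolding computable_def by auto
qed

lemma computable_eq: "computable F \<Longrightarrow> (\<And>A x. F A x = G A x) \<Longrightarrow> computable G"
  by (subgoal_tac "F = G") auto

lemma computable_funpow [computable_intros]:
  assumes "computable a" "computable n"
    and "computable (\<lambda>A y. f A (fst (prod_decode y)) (snd (prod_decode y)))"
  shows "computable (\<lambda>A x. ((\<lambda>u. f A u x) ^^ n A x) (a A x))"
proof -
  have "computable (\<lambda>A x. rec_nat (a A x) (\<lambda>m u. f A u x) (n A x))"
    by (intro computable_intros assms computable_comp[OF assms(3)]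
      computable_comp[OF assms(3), of "\<lambda>A y. snd (prod_decode y)", simplified])
  then show ?thesis
  proof (rule computable_eq)
    have "rec_nat (a A x) (\<lambda>m u. f A u x) k = ((\<lambda>u. f A u x) ^^ k) (a A x)" for A x k
      by (induction k) auto
    then show "rec_nat (a A x) (\<lambda>m u. f A u x) (n A x) = ((\<lambda>u. f A u x) ^^ n A x) (a A x)" for A x .
  qed
qed

lemma computable_sum [computable_intros]:
  assumes "computable n"
    and "computable (\<lambda>A y. f A (fst (prod_decode y)) (snd (prod_decode y)))"
  shows "computable (\<lambda>A x. \<Sum>i<n A x. f A i x)"
proof -
  have "computable (\<lambda>A y. f A (fst (prod_decode y)) (snd (prod_decode (snd (prod_decode y)))))"
    using computable_comp[OF assms(2), of "\<lambda>A y. prod_encode (fst (prod_decode y), snd (prod_decode (snd (prod_decode y))))"]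
    by (simp add: computable_intros)
  then have "computable (\<lambda>A x. rec_nat 0 (\<lambda>m u. u + f A m x) (n A x))"
    by (intro computable_intros assms)
  moreover have "rec_nat 0 (\<lambda>m u. u + f m) k = (\<Sum>i<k. f i)" for f :: "nat \<Rightarrow> nat" and k
    by (induction k) auto
  ultimately show ?thesis by simp
qed

lemma computable_le [computable_intros]:
  "computable a \<Longrightarrow> computable b \<Longrightarrow> computable (\<lambda>A x. of_bool (a A x \<le> b A x))"
  by (rule computable_eq[of "\<lambda>A x. 1 - (a A x - b A x)"]) (auto intro!: computable_intros)

lemma computable_less [computable_intros]:
  "computable a \<Longrightarrow> computable b \<Longrightarrow> computable (\<lambda>A x. of_bool (a A x < b A x))"
  by (rule computable_eq[of "\<lambda>A x. of_bool (Suc (a A x) \<le> b A x)"]) (auto intro!: computable_intros)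

lemma computable_not [computable_intros]:
  "computable (\<lambda>A x. of_bool (P A x)) \<Longrightarrow> computable (\<lambda>A x. of_bool (\<not> P A x))"
  by (rule computable_eq[of "\<lambda>A x. 1 - of_bool (P A x)"]) (auto intro!: computable_intros)

lemma computable_conj [computable_intros]:
  "computable (\<lambda>A x. of_bool (P A x)) \<Longrightarrow> computable (\<lambda>A x. of_bool (Q A x)) \<Longrightarrow>
    computable (\<lambda>A x. of_bool (P A x \<and> Q A x))"
  by (rule computable_eq[of "\<lambda>A x. of_bool (P A x) * of_bool (Q A x)"]) (auto intro!: computable_intros)

lemma computable_equal [computable_intros]:
  "computable a \<Longrightarrow> computable b \<Longrightarrow> computable (\<lambda>A x. of_bool (a A x = b A x))"
  by (rule computable_eq[of "\<lambda>A x. of_bool (a A x \<le> b A x \<and> b A x \<le> a A x)"])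
    (auto intro!: computable_intros)

lemma computable_if [computable_intros]:
  assumes "computable (\<lambda>A x. of_bool (P A x))" "computable a" "computable b"
  shows "computable (\<lambda>A x. if P A x then a A x else b A x)"
  by (rule computable_eq[of "\<lambda>A x. of_bool (P A x) * a A x + (1 - of_bool (P A x)) * b A x"])
    (auto intro!: computable_intros assms)

lemma computable_all_less [computable_intros]:
  assumes "computable n" "computable (\<lambda>A y. of_bool (P A (fst (prod_decode y)) (snd (prod_decode y))))"
  shows "computable (\<lambda>A x. of_bool (\<forall>i<n A x. P A i x))"
  by (rule computable_eq[of "\<lambda>A x. of_bool ((\<Sum>i<n A x. of_bool (\<not> P A i x)) = (0::nat))"])
    (intro computable_intros assms, auto)

lemma computable_half [computable_intros]:
  assumes "computable a"
  shows "computable (\<lambda>A x. a A x div 2)"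
proof -
  have "computable (\<lambda>A x. rec_nat 0 (\<lambda>m u. m - u) (a A x))"
    by (intro computable_intros assms)
  moreover have "rec_nat 0 (\<lambda>m u. m - u) k = k div 2" for k :: nat
    by (induction k) auto
  ultimately show ?thesis by simp
qed

lemma computable_odd [computable_intros]:
  assumes "computable a"
  shows "computable (\<lambda>A x. of_bool (odd (a A x)))"
  by (rule computable_eq[of "\<lambda>A x. a A x - 2 * (a A x div 2)"])
    (intro computable_intros assms, simp add: minus_mult_div_eq_mod odd_iff_mod_2_eq_one)

lemma computable_power2 [computable_intros]:
  assumes "computable a"
  shows "computable (\<lambda>A x. 2 ^ a A x)"
proof -
  have "computable (\<lambda>A x. rec_nat 1 (\<lambda>m u. 2 * u) (a A x))"
    by (intro computable_intros assms)
  moreover have "rec_nat 1 (\<lambda>m u. 2 * u) k = (2::nat) ^ k" for k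
    by (induction k) auto
  ultimately show ?thesis by (simp only:)
qed

lemma computable_bit [computable_intros]:
  assumes "computable a" "computable b"
  shows "computable (\<lambda>A x. of_bool (bit (a A x) (b A x)))"
proof -
  have "computable (\<lambda>A x. of_bool (odd (((\<lambda>u. u div 2) ^^ b A x) (a A x))))"
    by (intro computable_intros assms)
  moreover have "((\<lambda>u. u div 2) ^^ k) c = c div 2 ^ k" for k c :: nat
    by (induction k) (auto simp: div_mult2_eq[symmetric] mult.commute)
  ultimately show ?thesis by (simp add: bit_iff_odd)
qed

lemma computable_iff [computable_intros]:
  assumes "computable (\<lambda>A x. of_bool (P A x))" "computable (\<lambda>A x. of_bool (Q A x))"
  shows "computable (\<lambda>A x. of_bool (P A x \<longleftrightarrow> Q A x))"
  by (rule computable_eq[of "\<lambda>A x. of_bool ((of_bool (P A x) :: nat) = of_bool (Q A x))"])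
    (intro computable_intros assms, auto)

section \<open>Lists coded by numbers\<close>

abbreviation pair :: "nat \<Rightarrow> nat \<Rightarrow> nat" where
  "pair x y \<equiv> prod_encode (x, y)"
abbreviation pfst :: "nat \<Rightarrow> nat" where
  "pfst z \<equiv> fst (prod_decode z)"
abbreviation psnd :: "nat \<Rightarrow> nat" where
  "psnd z \<equiv> snd (prod_decode z)"

text \<open>
  These act on the codes of \<open>list_encode\<close>. Reading beyond the end of a list gives \<open>0\<close>, since both
  components of \<open>prod_decode 0\<close> are \<open>0\<close>.
\<close>

definition cons_code :: "nat \<Rightarrow> nat \<Rightarrow> nat" where
  "cons_code x c = Suc (pair x c)"
definition hd_code :: "nat \<Rightarrow> nat" where
  "hd_code c = pfst (c - 1)"
definition tl_code :: "nat \<Rightarrow> nat" where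
  "tl_code c = psnd (c - 1)"
definition nth_code :: "nat \<Rightarrow> nat \<Rightarrow> nat" where
  "nth_code c i = hd_code ((tl_code ^^ i) c)"

lemma hd_cons_code [simp]: "hd_code (cons_code x c) = x"
  and tl_cons_code [simp]: "tl_code (cons_code x c) = c"
  and cons_code_neq_0 [simp]: "cons_code x c \<noteq> 0"
  by (auto simp: hd_code_def tl_code_def cons_code_def)

lemma list_encode_Cons: "list_encode (x # xs) = cons_code x (list_encode xs)"
  by (simp add: cons_code_def)

declare list_encode.simps(2) [simp del]
declare list_encode_Cons [simp]

lemma funpow_tl_code_0: "(tl_code ^^ i) 0 = 0"
proof -
  have "prod_decode 0 = (0, 0)"
    using prod_encode_inverse[of "(0, 0)"] by (simp add: prod_encode_def)
  then have "tl_code 0 = 0" by (simp add: tl_code_def)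
  then show ?thesis by (induction i) auto
qed

lemma hd_code_0: "hd_code 0 = 0"
  using prod_encode_inverse[of "(0, 0)"] by (simp add: hd_code_def prod_encode_def)

lemma funpow_tl_code: "(tl_code ^^ i) (list_encode xs) = list_encode (drop i xs)"
proof (induction i arbitrary: xs)
  case (Suc i)
  show ?case
  proof (cases xs)
    case Nil
    then show ?thesis using funpow_tl_code_0[of "Suc i"] by simp
  next
    case (Cons y ys)
    then show ?thesis using Suc[of ys] by (simp del: funpow.simps add: funpow_Suc_right)
  qed
qed simp

lemma nth_code_list_encode: "nth_code (list_encode xs) i = (if i < length xs then xs ! i else 0)"
proof (cases "i < length xs")
  case True
  then show ?thesis
    unfolding nth_code_def funpow_tl_code by (simp add: Cons_nth_drop_Suc[symmetric])
next
  case False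
  then show ?thesis
    unfolding nth_code_def funpow_tl_code by (simp add: hd_code_0)
qed

lemma computable_cons_code [computable_intros]:
    "computable a \<Longrightarrow> computable b \<Longrightarrow> computable (\<lambda>A x. cons_code (a A x) (b A x))"
  and computable_hd_code [computable_intros]:
    "computable a \<Longrightarrow> computable (\<lambda>A x. hd_code (a A x))"
  and computable_tl_code [computable_intros]:
    "computable a \<Longrightarrow> computable (\<lambda>A x. tl_code (a A x))"
  unfolding cons_code_def hd_code_def tl_code_def by (intro computable_intros; simp)+

lemma computable_nth_code [computable_intros]:
  "computable a \<Longrightarrow> computable b \<Longrightarrow> computable (\<lambda>A x. nth_code (a A x) (b A x))"
  unfolding nth_code_def by (intro computable_intros; simp)

lemma le_cons_code: "c < cons_code x c"
  using le_prod_encode_2[of c x] by (simp add: cons_code_def)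

lemma length_le_list_encode: "length xs \<le> list_encode xs"
proof (induction xs)
  case (Cons x xs)
  then show ?case using le_cons_code[of "list_encode xs" x] by simp
qed simp

text \<open>
  The bound \<open>c\<close> suffices, as the code of a list is at least its length.
\<close>

definition length_code :: "nat \<Rightarrow> nat" where
  "length_code c = (\<Sum>i<c. of_bool (\<not> (tl_code ^^ i) c = 0))"

lemma list_encode_eq_0: "list_encode xs = 0 \<longleftrightarrow> xs = []"
  by (cases xs) auto

lemma length_code_list_encode: "length_code (list_encode xs) = length xs"
proof -
  have "length_code (list_encode xs) = (\<Sum>i<list_encode xs. of_bool (i < length xs))"
    unfolding length_code_def by (auto simp: funpow_tl_code list_encode_eq_0 not_le intro!: sum.cong)
  also have "\<dots> = card ({..<list_encode xs} \<inter> {i. i < length xs})"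
    by simp
  also have "{..<list_encode xs} \<inter> {i. i < length xs} = {..<length xs}"
    using length_le_list_encode[of xs] by auto
  finally show ?thesis by simp
qed

lemma computable_length_code [computable_intros]:
  "computable a \<Longrightarrow> computable (\<lambda>A x. length_code (a A x))"
  by (rule computable_comp[of "\<lambda>A x. length_code x"])
    (unfold length_code_def, (intro computable_intros | assumption)+)

section \<open>A stack machine interpreting programs\<close>

text \<open>
  The arguments of a composition are coded in reverse order: the machine evaluates them from the
  last to the first, so that the list of their values grows at its head.
\<close>

fun code :: "prog \<Rightarrow> nat" where
  "code Zero = pair 0 0"
| "code Succ = pair 1 0"
| "code (Proj i) = pair 2 i"
| "code Query = pair 3 0"
| "code (Comp f gs) = pair 4 (pair (code f) (list_encode (rev (map code gs))))"
| "code (PrimRec f g) = pair 5 (pair (code f) (code g))"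
| "code (Mu f) = pair 6 (code f)"

text \<open>
  A state \<open>pair v K\<close> of the machine consists of the value \<open>v\<close> returned last and a stack \<open>K\<close> of frames;
  it has halted if \<open>K\<close> is empty. A frame has a kind, some data and an argument list. The kinds
  \<open>0\<close> to \<open>6\<close> are the tags of \<open>code\<close>, so that \<open>pair (code p) xs\<close> is the frame that calls \<open>p\<close> on the
  list coded by \<open>xs\<close>. The other kinds say how to go on after a call has returned:
  \<^item> kinds \<open>7\<close> and \<open>8\<close> belong to a composition; their data are the outer program, the arguments
    still to be evaluated and the list of values found so far, to which kind \<open>8\<close> first adds \<open>v\<close>;
  \<^item> kind \<open>9\<close> continues a primitive recursion with the value \<open>v\<close> of the previous step;
  \<^item> kind \<open>10\<close> continues a minimisation by testing whether \<open>v\<close> is \<open>0\<close>.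
  
  All other kinds lead to the state \<open>stuck\<close>, which never changes and has not halted.
\<close>

definition frame :: "nat \<Rightarrow> nat \<Rightarrow> nat \<Rightarrow> nat" where
  "frame k d xs = pair (pair k d) xs"

definition push :: "nat \<Rightarrow> nat \<Rightarrow> nat \<Rightarrow> nat" where
  "push v fr K = pair v (cons_code fr K)"

definition stuck :: nat where
  "stuck = push 0 (frame 11 0 0) 0"

text \<open>
  The oracle is given by its answers \<open>0\<close> and \<open>1\<close>. The answer \<open>2\<close> stands for a bit that is not
  available; asking for it blocks the machine.
\<close>

definition run_frame :: "(nat \<Rightarrow> nat) \<Rightarrow> nat \<Rightarrow> nat \<Rightarrow> nat \<Rightarrow> nat \<Rightarrow> nat \<Rightarrow> nat" where
  "run_frame q v K k d xs =
    (if k = 0 then pair 0 K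
     else if k = 1 then pair (Suc (hd_code xs)) K
     else if k = 2 then pair (nth_code xs d) K
     else if k = 3 then (if q (hd_code xs) = 2 then stuck else pair (q (hd_code xs)) K)
     else if k = 4 then push v (frame 7 (pair d 0) xs) K
     else if k = 5 then
       (if hd_code xs = 0 then push v (pair (pfst d) (tl_code xs)) K
        else push v (frame 5 d (cons_code (hd_code xs - 1) (tl_code xs)))
          (cons_code (frame 9 (psnd d) (cons_code (hd_code xs - 1) (tl_code xs))) K))
     else if k = 6 then push v (pair d (cons_code 0 xs)) (cons_code (frame 10 d (cons_code 0 xs)) K)
     else if k = 7 then
       (if psnd (pfst d) = 0 then push v (pair (pfst (pfst d)) (psnd d)) K
        else push v (pair (hd_code (psnd (pfst d))) xs)
          (cons_code (frame 8 (pair (pair (pfst (pfst d)) (tl_code (psnd (pfst d)))) (psnd d)) xs) K))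
     else if k = 8 then push v (frame 7 (pair (pfst d) (cons_code v (psnd d))) xs) K
     else if k = 9 then push v (pair d (cons_code (hd_code xs) (cons_code v (tl_code xs)))) K
     else if k = 10 then
       (if v = 0 then pair (hd_code xs) K
        else push v (pair d (cons_code (Suc (hd_code xs)) (tl_code xs)))
          (cons_code (frame 10 d (cons_code (Suc (hd_code xs)) (tl_code xs))) K))
     else stuck)"

definition step :: "(nat \<Rightarrow> nat) \<Rightarrow> nat \<Rightarrow> nat" where
  "step q S = (if psnd S = 0 then S
    else run_frame q (pfst S) (tl_code (psnd S)) (pfst (pfst (hd_code (psnd S))))
      (psnd (pfst (hd_code (psnd S)))) (psnd (hd_code (psnd S))))"

lemma step_push:
  "step q (push v (frame k d xs) K) = run_frame q v K k d xs"
  by (simp add: step_def push_def frame_def)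

lemma step_halted: "psnd S = 0 \<Longrightarrow> step q S = S"
  by (simp add: step_def)

lemma step_stuck: "step q stuck = stuck"
  by (simp add: stuck_def step_push run_frame_def)

lemma funpow_step_halted: "psnd S = 0 \<Longrightarrow> (step q ^^ n) S = S"
  by (induction n) (auto simp: step_halted)

lemma stuck_not_halted: "psnd stuck \<noteq> 0"
  by (simp add: stuck_def push_def)

definition reaches :: "bitseq \<Rightarrow> nat \<Rightarrow> nat \<Rightarrow> bool" where
  "reaches A S S' \<longleftrightarrow> (\<exists>n. (step (\<lambda>i. of_bool (A i)) ^^ n) S = S')"

lemma reaches_trans [trans]: "reaches A S S' \<Longrightarrow> reaches A S' S'' \<Longrightarrow> reaches A S S''"
  unfolding reaches_def
  by (metis funpow_add comp_apply)

lemma reaches_step: "step (\<lambda>i. of_bool (A i)) S = S' \<Longrightarrow> reaches A S S'"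
  unfolding reaches_def by (rule exI[of _ 1]) simp

lemma reaches_push:
  "run_frame (\<lambda>i. of_bool (A i)) v K k d xs = S' \<Longrightarrow> reaches A (push v (frame k d xs) K) S'"
  by (rule reaches_step) (simp add: step_push)

lemma reaches_push_pair:
  "run_frame (\<lambda>i. of_bool (A i)) v K k d xs = S' \<Longrightarrow> reaches A (push v (pair (pair k d) xs) K) S'"
  using reaches_push[of A v K k d xs S'] by (simp add: frame_def)

abbreviation call :: "prog \<Rightarrow> nat list \<Rightarrow> nat" where
  "call p xs \<equiv> pair (code p) (list_encode xs)"

text \<open>
  In the case of a composition the last \<open>length us - n\<close> arguments have been evaluated, and the
  induction is on the number \<open>n\<close> of the remaining ones. In the case of a minimisation, it is on the
  distance to the least zero. The value \<open>u\<close> returned before the call is arbitrary, since it is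
  overwritten.
\<close>

lemma eval_reaches:
  assumes "eval A p xs v"
  shows "reaches A (push u (call p xs) K) (pair v K)"
  using assms
proof (induction arbitrary: u K rule: eval.induct)
  case (Zero xs)
  show ?case by (auto intro!: reaches_push_pair simp: run_frame_def)
next
  case (Succ n)
  show ?case by (auto intro!: reaches_push_pair simp: run_frame_def)
next
  case (Proj i xs)
  then show ?case by (auto intro!: reaches_push_pair simp: run_frame_def nth_code_list_encode)
next
  case (Query n)
  show ?case by (auto intro!: reaches_push_pair simp: run_frame_def)
next
  case (Comp xs gs us f v)
  have len: "length gs = length us"
    using Comp.IH(1) by (rule list_all2_lengthD)
  have args: "reaches A
      (push w (frame 7 (pair (pair (code f) (list_encode (rev (map code (take n gs)))))
        (list_encode (drop n us))) (list_encode xs)) K)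
      (pair v K)" if "n \<le> length gs" for n w
    using that
  proof (induction n arbitrary: w)
    case 0
    have "reaches A (push w (frame 7 (pair (pair (code f) 0) (list_encode us)) (list_encode xs)) K)
      (push w (call f us) K)"
      by (rule reaches_push) (simp add: run_frame_def)
    also have "reaches A \<dots> (pair v K)" by (rule Comp.IH(2))
    finally show ?case by simp
  next
    case (Suc n)
    let ?F = "\<lambda>k gs us. frame k (pair (pair (code f) (list_encode (rev (map code gs)))) (list_encode us))
      (list_encode xs)"
    have n: "n < length gs" "n < length us" using Suc.prems len by auto
    have "reaches A (push w (?F 7 (take (Suc n) gs) (drop (Suc n) us)) K)
      (push w (call (gs ! n) xs) (cons_code (?F 8 (take n gs) (drop (Suc n) us)) K))"
      by (rule reaches_push) (simp add: run_frame_def take_Suc_conv_app_nth n)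
    also have "reaches A \<dots> (push (us ! n) (?F 8 (take n gs) (drop (Suc n) us)) K)"
      using list_all2_nthD[OF Comp.IH(1) n(1)] by (simp add: push_def)
    also have "reaches A \<dots> (push (us ! n) (?F 7 (take n gs) (drop n us)) K)"
      by (rule reaches_push) (simp add: run_frame_def Cons_nth_drop_Suc[symmetric] n)
    also have "reaches A \<dots> (pair v K)" using Suc by simp
    finally show ?case .
  qed
  have "reaches A (push u (call (Comp f gs) xs) K)
    (push u (frame 7 (pair (pair (code f) (list_encode (rev (map code gs)))) 0) (list_encode xs)) K)"
    unfolding code.simps by (rule reaches_push_pair) (simp add: run_frame_def)
  also have "reaches A \<dots> (pair v K)" using args[of "length gs" u] len by simp
  finally show ?case .
next
  case (PrimRec_0 f xs v g)
  have "reaches A (push u (call (PrimRec f g) (0 # xs)) K) (push u (call f xs) K)"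
    unfolding code.simps by (rule reaches_push_pair) (simp add: run_frame_def)
  also have "reaches A \<dots> (pair v K)" by (rule PrimRec_0.IH)
  finally show ?case .
next
  case (PrimRec_Suc f g n xs w v)
  let ?F = "frame 9 (code g) (list_encode (n # xs))"
  have "reaches A (push u (call (PrimRec f g) (Suc n # xs)) K)
    (push u (call (PrimRec f g) (n # xs)) (cons_code ?F K))"
    unfolding code.simps by (rule reaches_push_pair) (simp add: run_frame_def frame_def)
  also have "reaches A \<dots> (push w ?F K)"
    using PrimRec_Suc.IH(1) by (simp add: push_def)
  also have "reaches A \<dots> (push w (call g (n # w # xs)) K)"
    by (rule reaches_push) (simp add: run_frame_def)
  also have "reaches A \<dots> (pair v K)" by (rule PrimRec_Suc.IH(2))
  finally show ?case .
next
  case (Mu f n xs)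
  let ?S = "\<lambda>u m. push u (call f (m # xs)) (cons_code (frame 10 (code f) (list_encode (m # xs))) K)"
  have loop: "reaches A (?S u (n - m)) (pair n K)" if "m \<le> n" for u m
    using that
  proof (induction m arbitrary: u)
    case 0
    have "reaches A (?S u n) (push 0 (frame 10 (code f) (list_encode (n # xs))) K)"
      using Mu.IH(1) by (simp add: push_def)
    also have "reaches A \<dots> (pair n K)"
      by (rule reaches_push) (simp add: run_frame_def)
    finally show ?case by simp
  next
    case (Suc m)
    let ?m = "n - Suc m"
    have m: "Suc ?m = n - m" "?m < n" using Suc.prems by auto
    then obtain k where k: "\<And>u K. reaches A (push u (call f (?m # xs)) K) (pair (Suc k) K)"
      using Mu.IH(2) by blast
    have "reaches A (?S u ?m) (push (Suc k) (frame 10 (code f) (list_encode (?m # xs))) K)"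
      using k by (simp add: push_def)
    also have "reaches A \<dots> (?S (Suc k) (n - m))"
      by (rule reaches_push) (simp add: run_frame_def m)
    also have "reaches A \<dots> (pair n K)" using Suc by simp
    finally show ?case .
  qed
  have "reaches A (push u (call (Mu f) xs) K) (?S u 0)"
    unfolding code.simps by (rule reaches_push_pair) (simp add: run_frame_def)
  also have "reaches A \<dots> (pair n K)" using loop[of n u] by simp
  finally show ?case .
qed

definition prefix_oracle :: "bitseq \<Rightarrow> nat \<Rightarrow> nat \<Rightarrow> nat" where
  "prefix_oracle A t i = (if i < t then of_bool (A i) else 2)"

lemma step_oracle_extend:
  assumes "step q S \<noteq> stuck" and q: "\<And>i. q i \<noteq> 2 \<Longrightarrow> q' i = q i"
  shows "step q' S = step q S"
proof (cases "psnd S \<noteq> 0 \<and> pfst (pfst (hd_code (psnd S))) = 3")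
  case True
  then have "q (hd_code (psnd (hd_code (psnd S)))) \<noteq> 2"
    using assms(1) by (auto simp: step_def run_frame_def)
  with True q show ?thesis by (simp add: step_def run_frame_def)
next
  case False
  then show ?thesis by (auto simp: step_def run_frame_def)
qed

text \<open>
  A blocked machine stays blocked, so a machine that is not blocked in the end has never asked for an
  unavailable bit.
\<close>

lemma funpow_step_oracle_extend:
  assumes "(step q ^^ n) S \<noteq> stuck" and q: "\<And>i. q i \<noteq> 2 \<Longrightarrow> q' i = q i"
  shows "(step q' ^^ n) S = (step q ^^ n) S"
  using assms(1)
proof (induction n)
  case (Suc n)
  then have "(step q ^^ n) S \<noteq> stuck" using step_stuck by auto
  with Suc show ?case using step_oracle_extend[of q "(step q ^^ n) S" q'] q by simp
qed simp

lemma step_finite_use: "\<exists>i. \<forall>q'. q' i = q i \<longrightarrow> step q' S = step q S"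
  by (rule exI[of _ "hd_code (psnd (hd_code (psnd S)))"]) (simp add: step_def run_frame_def)

lemma funpow_step_prefix_oracle:
  "\<exists>t0. \<forall>t\<ge>t0. (step (prefix_oracle A t) ^^ n) S = (step (\<lambda>i. of_bool (A i)) ^^ n) S"
proof (induction n)
  case 0
  then show ?case by simp
next
  case (Suc n)
  let ?q = "\<lambda>i. of_bool (A i)"
  from Suc obtain t0 where t0: "\<And>t. t \<ge> t0 \<Longrightarrow> (step (prefix_oracle A t) ^^ n) S = (step ?q ^^ n) S"
    by blast
  obtain i where i: "\<And>q'. q' i = ?q i \<Longrightarrow> step q' ((step ?q ^^ n) S) = step ?q ((step ?q ^^ n) S)"
    using step_finite_use[of ?q "(step ?q ^^ n) S"] by blast
  have "(step (prefix_oracle A t) ^^ Suc n) S = (step ?q ^^ Suc n) S" if "t \<ge> max t0 (Suc i)" for t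
    using t0[of t] i[of "prefix_oracle A t"] that by (simp add: prefix_oracle_def)
  then show ?case by blast
qed

text \<open>
  The bound \<open>t\<close> serves both as the number of steps and as the number of oracle bits.
\<close>

definition run :: "nat \<Rightarrow> bitseq \<Rightarrow> nat \<Rightarrow> nat \<Rightarrow> nat" where
  "run c A t n = (step (prefix_oracle A t) ^^ t) (push 0 (pair c (list_encode [n])) 0)"

definition halted :: "nat \<Rightarrow> bitseq \<Rightarrow> nat \<Rightarrow> nat \<Rightarrow> bool" where
  "halted c A t n \<longleftrightarrow> psnd (run c A t n) = 0"

text \<open>
  A computation that has halted is not changed by more time, nor by a different oracle that has the
  same first \<open>t\<close> bits. This makes the set of oracles on which a computation has halted by time
  \<open>t\<close> a finite union of cylinders.
\<close>

lemma run_extend: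
  assumes "halted c A t n" "t \<le> t'" "\<And>i. i < t \<Longrightarrow> A' i = A i"
  shows "run c A' t' n = run c A t n"
proof -
  let ?S = "push 0 (pair c (list_encode [n])) 0"
  have "run c A t n \<noteq> stuck" using assms(1) stuck_not_halted unfolding halted_def by metis
  then have "(step (prefix_oracle A' t') ^^ t) ?S = run c A t n"
    unfolding run_def
    by (rule funpow_step_oracle_extend) (use assms in \<open>auto simp: prefix_oracle_def split: if_splits\<close>)
  then have "(step (prefix_oracle A' t') ^^ (t' - t + t)) ?S = run c A t n"
    unfolding funpow_add comp_apply using assms(1) by (simp add: funpow_step_halted halted_def)
  then show ?thesis using assms(2) by (simp add: run_def)
qed

lemma eval_run:
  assumes "eval A p [n] v"
  shows "\<exists>t. run (code p) A t n = pair v 0"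
proof -
  let ?S = "push 0 (call p [n]) 0" and ?q = "\<lambda>i. of_bool (A i)"
  from eval_reaches[OF assms, of 0 0] obtain k where k: "(step ?q ^^ k) ?S = pair v 0"
    unfolding reaches_def by blast
  obtain t0 where t0: "\<And>t. t \<ge> t0 \<Longrightarrow> (step (prefix_oracle A t) ^^ k) ?S = (step ?q ^^ k) ?S"
    using funpow_step_prefix_oracle[where n = k] by blast
  let ?t = "max t0 k"
  have "(step (prefix_oracle A ?t) ^^ (?t - k + k)) ?S = pair v 0"
    unfolding funpow_add comp_apply using t0[of ?t] k by (simp add: funpow_step_halted)
  then have "run (code p) A ?t n = pair v 0" by (simp add: run_def)
  then show ?thesis by blast
qed

lemma computable_run_frame:
  assumes "computable (\<lambda>A y. q A (pfst y) (psnd y))"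
    "computable v" "computable K" "computable k" "computable d" "computable xs"
  shows "computable (\<lambda>A x. run_frame (\<lambda>i. q A i x) (v A x) (K A x) (k A x) (d A x) (xs A x))"
proof -
  have q: "computable (\<lambda>A x. q A (a A x) x)" if "computable a" for a
    using computable_comp[OF assms(1), of "\<lambda>A x. pair (a A x) x"] that
    by (simp add: computable_intros)
  show ?thesis
    unfolding run_frame_def push_def frame_def
    by (intro computable_intros q assms)
qed

lemma computable_step [computable_intros]:
  assumes "computable (\<lambda>A y. q A (pfst y) (psnd y))" "computable S"
  shows "computable (\<lambda>A x. step (\<lambda>i. q A i x) (S A x))"
  unfolding step_def by (intro computable_intros computable_run_frame assms)

lemma computable_run_bits [computable_intros]:
  assumes "computable c" "computable b" "computable t" "computable n"
  shows "computable (\<lambda>A x. run (c A x) (bit (b A x)) (t A x) (n A x))"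
  unfolding run_def prefix_oracle_def push_def list_encode_Cons list_encode.simps(1)
  by (intro computable_intros assms computable_comp[OF assms(2)] computable_comp[OF assms(3)])

section \<open>The index function\<close>

text \<open>
  The number \<open>e = pair c (pair L a)\<close> stands for the program with code \<open>c\<close> and the cylinder given by the
  first \<open>L\<close> binary digits of \<open>a\<close>; the number reserved for them is \<open>2 * e + 1\<close>. Oracles are
  represented by the binary expansions of the numbers below \<open>2 ^ t\<close>. The condition says that the
  program has halted by time \<open>t\<close> on the reserved number for more than \<open>3/4\<close> of the
  oracles in the cylinder, see \<open>trigger_iff\<close>.
\<close>

definition trigger :: "nat \<Rightarrow> nat \<Rightarrow> bool" where
  "trigger e t \<longleftrightarrow> pfst (psnd e) \<le> t \<and>
     3 * 2 ^ t < 4 * 2 ^ pfst (psnd e) *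
       (\<Sum>b<(2::nat) ^ t. of_bool ((\<forall>i<pfst (psnd e). bit b i \<longleftrightarrow> bit (psnd (psnd e)) i) \<and>
          halted (pfst e) (bit b) t (2 * e + 1)) :: nat)"

text \<open>
  At \<open>s = pair e t\<close> the number reserved for \<open>e\<close> is taken if \<open>t\<close> is the first time at which \<open>e\<close> triggers.
  The even values fill the other places and keep the function injective. Since \<open>t \<le> s\<close>, none
  of the first \<open>t\<close> bits of \<open>y \<oplus> r\<close> is \<open>y s\<close>.
\<close>

definition source :: "nat \<Rightarrow> nat" where
  "source s = (if trigger (pfst s) (psnd s) \<and> (\<forall>t<psnd s. \<not> trigger (pfst s) t)
     then 2 * pfst s + 1 else 2 * s)"

lemma computable_trigger [computable_intros]:
  assumes "computable e" "computable t"
  shows "computable (\<lambda>A x. of_bool (trigger (e A x) (t A x)))"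
  unfolding trigger_def halted_def
  by (intro computable_intros assms computable_comp[OF assms(1)] computable_comp[OF assms(2)])

lemma computable_source [computable_intros]:
  assumes "computable s"
  shows "computable (\<lambda>A x. source (s A x))"
  unfolding source_def
  by (intro computable_intros assms computable_comp[OF assms])

lemma not_trigger_0: "\<not> trigger e 0"
  by (auto simp: trigger_def halted_def run_def push_def)

lemma pair_decode: "pair (pfst s) (psnd s) = s"
  by simp

text \<open>
  If \<open>e\<close> triggers at time \<open>t\<close>, then \<open>t > 0\<close>, so \<open>e < pair e t\<close>. The bound makes it possible to
  compute \<open>k\<close> scrambled bits from \<open>2 * k\<close> bits.
\<close>

lemma source_le: "source s \<le> 2 * s"
proof (cases "trigger (pfst s) (psnd s)")
  case True
  then have "psnd s > 0" using not_trigger_0 by (metis gr0I)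
  have "pfst s < triangle (pfst s + psnd s) + pfst s"
    using \<open>psnd s > 0\<close> by (cases "psnd s") auto
  also have "\<dots> = pair (pfst s) (psnd s)" by (simp only: prod_encode_def prod.case)
  also have "\<dots> = s" by (rule pair_decode)
  finally show ?thesis by (simp add: source_def)
qed (simp add: source_def)

lemma inj_source: "inj source"
proof (rule injI)
  fix s s' assume eq: "source s = source s'"
  let ?P = "\<lambda>s. trigger (pfst s) (psnd s) \<and> (\<forall>t<psnd s. \<not> trigger (pfst s) t)"
  have odd: "odd (source s) \<longleftrightarrow> ?P s" for s by (auto simp: source_def)
  show "s = s'"
  proof (cases "?P s")
    case True
    then have P: "?P s" "?P s'" using odd eq by metis+
    then have "pfst s = pfst s'" using eq by (simp add: source_def)
    moreover from this P have "psnd s = psnd s'" by (metis linorder_neqE_nat)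
    ultimately show ?thesis by (metis prod_decode_eq prod_eqI)
  next
    case False
    then have "\<not> ?P s'" using odd eq by metis
    have "source s = 2 * s" by (simp only: source_def if_not_P[OF False])
    moreover have "source s' = 2 * s'" by (simp only: source_def if_not_P[OF \<open>\<not> ?P s'\<close>])
    ultimately show ?thesis using eq by linarith
  qed
qed

lemma source_0: "source 0 = 0"
  using source_le[of 0] by simp

section \<open>The coin-tossing measure\<close>

abbreviation coin :: "bool measure" where
  "coin \<equiv> measure_pmf (bernoulli_pmf (1/2))"

abbreviation coins :: "bitseq measure" where
  "coins \<equiv> \<Pi>\<^sub>M i\<in>UNIV. coin"

interpretation coins: product_prob_space "\<lambda>_::nat. coin" UNIV
  by unfold_locales

lemma space_coins [simp]: "space coins = UNIV"
  by (simp add: space_PiM)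

lemma measure_coin_singleton: "measure coin {b} = 1/2"
  by (cases b) (simp_all add: measure_pmf_single)

lemma mem_emb_coins:
  "x \<in> prod_emb UNIV (\<lambda>_. coin) J (Pi\<^sub>E J H) \<longleftrightarrow> (\<forall>i\<in>J. x i \<in> H i)"
  by (simp add: prod_emb_def PiE_iff)

lemma measure_coins_cylinder:
  assumes "finite J"
  shows "measure coins {x. \<forall>i\<in>J. x i = a i} = (1/2) ^ card J"
proof -
  have "{x. \<forall>i\<in>J. x i = a i} = prod_emb UNIV (\<lambda>_. coin) J (Pi\<^sub>E J (\<lambda>i. {a i}))"
    by (simp only: set_eq_iff mem_emb_coins mem_Collect_eq singleton_iff simp_thms)
  also have "measure coins \<dots> = (\<Prod>i\<in>J. measure coin {a i})"
    by (rule coins.measure_PiM_emb) (use assms in auto)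
  finally show ?thesis by (simp add: measure_coin_singleton)
qed

lemma sets_coins_cylinder:
  assumes "finite J" shows "{x. \<forall>i\<in>J. x i = a i} \<in> sets coins"
proof -
  have "{x \<in> space coins. \<forall>i\<in>J. x i = a i} \<in> sets coins"
    using assms by measurable
  then show ?thesis by simp
qed

lemma distr_coins_reindex:
  assumes "inj h"
  shows "distr coins coins (\<lambda>x n. x (h n)) = coins"
  by (rule distr_PiM_reindex[of UNIV "\<lambda>_. coin" h UNIV, unfolded restrict_UNIV])
    (use assms in \<open>auto intro: prob_space_measure_pmf\<close>)

lemma measurable_reindex [measurable]: "(\<lambda>x n. x (h n)) \<in> coins \<rightarrow>\<^sub>M coins"
  by (rule measurable_PiM_single') (auto intro!: measurable_component_singleton)

text \<open>
  Selecting coins without repetition gives again independent fair coins.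
\<close>

lemma measure_coins_reindex:
  assumes "inj h" "X \<in> sets coins"
  shows "measure coins {x. (\<lambda>n. x (h n)) \<in> X} = measure coins X"
proof -
  have "measure coins X = measure (distr coins coins (\<lambda>x n. x (h n))) X"
    using assms(1) by (simp add: distr_coins_reindex)
  also have "\<dots> = measure coins ((\<lambda>x n. x (h n)) -` X \<inter> space coins)"
    using assms(2) by (intro measure_distr) auto
  finally show ?thesis by (simp add: vimage_def)
qed

lemma coin_Not: "emeasure coin (Not -` X) = emeasure coin X"
proof -
  have "map_pmf Not (bernoulli_pmf (1/2)) = bernoulli_pmf (1/2)"
  proof (rule pmf_eqI)
    fix b show "pmf (map_pmf Not (bernoulli_pmf (1/2))) b = pmf (bernoulli_pmf (1/2)) b"
      using pmf_map_inj'[of Not "bernoulli_pmf (1/2)" "\<not> b"] by (cases b) (auto simp: inj_on_def)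
  qed
  then show ?thesis by (metis emeasure_map_pmf)
qed

lemma measurable_flip: "(\<lambda>x :: bitseq. x(k := \<not> x k)) \<in> coins \<rightarrow>\<^sub>M coins"
proof (rule measurable_PiM_single')
  show "(\<lambda>x. (x(k := \<not> x k)) i) \<in> coins \<rightarrow>\<^sub>M coin" for i
    by (cases "i = k") (auto cong: measurable_cong_sets)
qed auto

lemma measure_coins_flip:
  assumes X: "X \<in> sets coins"
  shows "measure coins {x. x(k := \<not> x k) \<in> X} = measure coins X"
proof -
  let ?T = "\<lambda>x :: bitseq. x(k := \<not> x k)"
  note T = measurable_flip[of k]
  have "distr coins coins ?T = coins"
  proof (rule coins.PiM_eq)
    fix J :: "nat set" and F :: "nat \<Rightarrow> bool set"
    assume J: "finite J" 
    let ?emb = "\<lambda>F. prod_emb UNIV (\<lambda>_. coin) J (Pi\<^sub>E J F)"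
    let ?G = "\<lambda>i. if i = k then Not -` F i else F i"
    have "emeasure (distr coins coins ?T) (?emb F) = emeasure coins (?T -` ?emb F \<inter> space coins)"
      by (intro emeasure_distr T sets_PiM_I J) auto
    also have "?T -` ?emb F \<inter> space coins = ?emb ?G"
    proof -
      have "(?T x) i \<in> F i \<longleftrightarrow> x i \<in> ?G i" for x i by simp
      then show ?thesis by (simp only: mem_emb_coins set_eq_iff vimage_def mem_Collect_eq Int_iff space_coins UNIV_I simp_thms)
    qed
    also have "emeasure coins (?emb ?G) = (\<Prod>i\<in>J. emeasure coin (?G i))"
      using J by (intro coins.emeasure_PiM_emb) auto
    also have "\<dots> = (\<Prod>i\<in>J. emeasure coin (F i))"
      by (intro prod.cong) (auto simp: coin_Not)
    finally show "emeasure (distr coins coins ?T) (?emb F) = (\<Prod>i\<in>J. emeasure coin (F i))" .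
  qed simp
  then have "measure coins X = measure (distr coins coins ?T) X" by (simp only:)
  also have "\<dots> = measure coins (?T -` X \<inter> space coins)"
    by (intro measure_distr T X)
  also have "?T -` X \<inter> space coins = {x. ?T x \<in> X}"
    unfolding space_coins by blast
  finally show ?thesis by (rule sym)
qed

definition determined :: "nat \<Rightarrow> bitseq set \<Rightarrow> bool" where
  "determined L X \<longleftrightarrow> (\<forall>x y. (\<forall>i<L. x i = y i) \<longrightarrow> x \<in> X \<longrightarrow> y \<in> X)"

text \<open>
  The prefix is given by the binary digits of \<open>a\<close>, so that cylinders are indexed by numbers and can
  be counted.
\<close>

definition cylinder :: "nat \<Rightarrow> nat \<Rightarrow> bitseq set" where
  "cylinder L a = {x. \<forall>i<L. x i = bit a i}"

lemma cylinder_eq_Ball: "cylinder L a = {x. \<forall>i\<in>{..<L}. x i = bit a i}"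
  by (auto simp: cylinder_def)

lemma sets_cylinder [measurable]: "cylinder L a \<in> sets coins"
  unfolding cylinder_eq_Ball by (rule sets_coins_cylinder) simp

lemma measure_cylinder: "measure coins (cylinder L a) = (1/2) ^ L"
  unfolding cylinder_eq_Ball using measure_coins_cylinder[of "{..<L}" "bit a"] by simp

lemma cylinder_cover: "\<exists>b<2 ^ L. x \<in> cylinder L b"
proof (induction L)
  case 0
  then show ?case by (auto simp: cylinder_def)
next
  case (Suc L)
  then obtain b :: nat where b: "b < 2 ^ L" "\<And>i. i < L \<Longrightarrow> x i = bit b i" by (auto simp: cylinder_def)
  let ?b = "if x L then set_bit L b else b"
  have nb: "\<not> bit b L" using b(1) by (simp add: bit_iff_odd)
  have "?b < 2 ^ Suc L" using b(1) nb by (simp add: set_bit_eq)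
  moreover have "x \<in> cylinder (Suc L) ?b"
    using b(2) nb by (auto simp: cylinder_def bit_set_bit_iff less_Suc_eq)
  ultimately show ?case by blast
qed

lemma cylinder_disjoint:
  assumes "b < 2 ^ L" "b' < 2 ^ L" "x \<in> cylinder L b" "x \<in> cylinder L b'"
  shows "b = b'"
proof (rule bit_eqI)
  have hi: "\<not> bit c i" if "c < 2 ^ L" "\<not> i < L" for c i :: nat
  proof -
    have "(2::nat) ^ L \<le> 2 ^ i" using that by (intro power_increasing) auto
    then have "c < 2 ^ i" using that(1) by linarith
    then show ?thesis by (simp add: bit_iff_odd)
  qed
  show "bit b i = bit b' i" for i
    using assms hi by (cases "i < L") (auto simp: cylinder_def)
qed

lemma determined_Union:
  assumes "determined L X"
  shows "X = (\<Union>b\<in>{b :: nat. b < 2 ^ L \<and> bit b \<in> X}. cylinder L b)"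
proof (intro equalityI subsetI)
  fix x assume x: "x \<in> X"
  obtain b where "b < 2 ^ L" "x \<in> cylinder L b" using cylinder_cover by blast
  with x assms show "x \<in> (\<Union>b\<in>{b :: nat. b < 2 ^ L \<and> bit b \<in> X}. cylinder L b)"
    unfolding determined_def cylinder_def by blast
next
  fix x assume "x \<in> (\<Union>b\<in>{b :: nat. b < 2 ^ L \<and> bit b \<in> X}. cylinder L b)"
  then obtain b :: nat where b: "bit b \<in> X" "\<forall>i<L. bit b i = x i" by (auto simp: cylinder_def)
  from assms[unfolded determined_def, rule_format, of "bit b" x] b show "x \<in> X" by blast
qed

lemma disjoint_family_cylinder:
  "disjoint_family_on (\<lambda>b. B \<inter> cylinder L b) {b :: nat. b < 2 ^ L \<and> P b}"
  using cylinder_disjoint[of _ L] unfolding disjoint_family_on_def by blast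

lemma sets_determined:
  assumes "determined L X"
  shows "X \<in> sets coins"
proof -
  have "(\<Union>b\<in>{b :: nat. b < 2 ^ L \<and> bit b \<in> X}. cylinder L b) \<in> sets coins"
    by (intro sets.finite_UN sets_cylinder) simp
  then show ?thesis by (simp only: determined_Union[OF assms, symmetric])
qed

lemma measure_Int_determined:
  assumes "determined L X" "B \<in> sets coins"
  shows "measure coins (B \<inter> X) = (\<Sum>b | b < (2::nat) ^ L \<and> bit b \<in> X. measure coins (B \<inter> cylinder L b))"
proof -
  let ?S = "{b :: nat. b < 2 ^ L \<and> bit b \<in> X}"
  have "measure coins (\<Union>b\<in>?S. B \<inter> cylinder L b) = (\<Sum>b\<in>?S. measure coins (B \<inter> cylinder L b))"
  proof (rule coins.P.finite_measure_finite_Union)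
    show "(\<lambda>b. B \<inter> cylinder L b) ` ?S \<subseteq> sets coins"
      using assms(2) sets_cylinder by blast
  qed (simp_all add: disjoint_family_cylinder)
  also have "(\<Union>b\<in>?S. B \<inter> cylinder L b) = B \<inter> (\<Union>b\<in>?S. cylinder L b)"
    by blast
  also have "(\<Union>b\<in>?S. cylinder L b) = X"
    by (rule determined_Union[OF assms(1), symmetric])
  finally show ?thesis .
qed

lemma measure_determined:
  assumes "determined L X"
  shows "measure coins X = real (card {b :: nat. b < 2 ^ L \<and> bit b \<in> X}) / 2 ^ L"
  using measure_Int_determined[OF assms, of UNIV] sets.top[of coins]
  by (simp add: measure_cylinder power_one_over)

text \<open>
  These are the open sets of Cantor space, stated without topology.
\<close>

definition finitely_confirmed :: "bitseq set \<Rightarrow> bool" where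
  "finitely_confirmed X \<longleftrightarrow> (\<forall>x\<in>X. \<exists>L. \<forall>y. (\<forall>i<L. y i = x i) \<longrightarrow> y \<in> X)"

lemma finitely_confirmed_INT:
  assumes "finite I" "\<And>i. i \<in> I \<Longrightarrow> finitely_confirmed (U i)"
  shows "finitely_confirmed (\<Inter>i\<in>I. U i)"
  unfolding finitely_confirmed_def
proof
  fix x assume "x \<in> (\<Inter>i\<in>I. U i)"
  then have "\<forall>i\<in>I. \<exists>L. \<forall>y. (\<forall>j<L. y j = x j) \<longrightarrow> y \<in> U i"
    using assms(2) unfolding finitely_confirmed_def by blast
  then obtain L where L: "\<And>i y. i \<in> I \<Longrightarrow> (\<forall>j<L i. y j = x j) \<Longrightarrow> y \<in> U i"
    by metis
  have "y \<in> (\<Inter>i\<in>I. U i)" if y: "\<forall>j<(\<Sum>i\<in>I. L i). y j = x j" for y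
  proof
    fix i assume i: "i \<in> I"
    then have "L i \<le> (\<Sum>i\<in>I. L i)" using assms(1) by (simp add: member_le_sum)
    then show "y \<in> U i" using y by (intro L[OF i]) auto
  qed
  then show "\<exists>L. \<forall>y. (\<forall>i<L. y i = x i) \<longrightarrow> y \<in> (\<Inter>i\<in>I. U i)" by blast
qed

text \<open>
  The part of \<open>X\<close> that is confirmed by the first \<open>L\<close> bits. These sets exhaust an open set \<open>X\<close> from
  within.
\<close>

definition core :: "nat \<Rightarrow> bitseq set \<Rightarrow> bitseq set" where
  "core L X = {x. \<forall>y. (\<forall>i<L. y i = x i) \<longrightarrow> y \<in> X}"

lemma determined_core: "determined L (core L X)"
  unfolding determined_def core_def by auto

lemma incseq_core: "incseq (\<lambda>L. core L X)"
  by (rule incseq_SucI) (auto simp: core_def)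

lemma UN_core:
  assumes "finitely_confirmed X"
  shows "(\<Union>L. core L X) = X"
  using assms by (auto simp: core_def finitely_confirmed_def)

lemma sets_finitely_confirmed:
  assumes "finitely_confirmed X"
  shows "X \<in> sets coins"
proof -
  have "(\<Union>L. core L X) \<in> sets coins"
    by (rule sets.countable_UN) (auto intro: sets_determined[OF determined_core])
  then show ?thesis by (simp only: UN_core[OF assms])
qed

text \<open>
  A weak form of the Lebesgue density theorem for countable intersections of open sets. If \<open>B\<close> had
  density at most \<open>c < 1\<close> in every cylinder, then \<open>measure (B \<inter> X) \<le> c * measure X\<close> would hold for
  all finite unions \<open>X\<close> of cylinders, then for all open \<open>X\<close> by exhaustion, and finally for
  \<open>X = B\<close>, because \<open>B\<close> is approximated from outside by the open sets \<open>V n\<close>.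
\<close>

lemma exists_dense_cylinder:
  fixes U :: "nat \<Rightarrow> bitseq set"
  defines "B \<equiv> \<Inter>n. U n"
  assumes U: "\<And>n. finitely_confirmed (U n)" and pos: "measure coins B > 0" and c: "c < 1"
  shows "\<exists>L a. measure coins (B \<inter> cylinder L a) > c * (1/2) ^ L"
proof (rule ccontr)
  assume "\<not> ?thesis"
  then have sparse: "measure coins (B \<inter> cylinder L a) \<le> c * (1/2) ^ L" for L a
    by (simp add: not_less)
  have B: "B \<in> sets coins"
    unfolding B_def by (rule sets.countable_INT) (auto intro: sets_finitely_confirmed[OF U])
  have det: "measure coins (B \<inter> X) \<le> c * measure coins X" if X: "determined L X" for L X
  proof -
    have "measure coins (B \<inter> X) \<le> (\<Sum>b | b < (2::nat) ^ L \<and> bit b \<in> X. c * (1/2) ^ L)"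
      unfolding measure_Int_determined[OF X B] by (intro sum_mono sparse)
    then show ?thesis by (simp add: measure_determined[OF X] power_one_over field_simps)
  qed
  have conf: "measure coins (B \<inter> X) \<le> c * measure coins X" if X: "finitely_confirmed X" for X
  proof (rule LIMSEQ_le)
    have "(\<lambda>L. measure coins (B \<inter> core L X)) \<longlonglongrightarrow> measure coins (\<Union>L. B \<inter> core L X)"
    proof (rule coins.P.finite_Lim_measure_incseq)
      show "range (\<lambda>L. B \<inter> core L X) \<subseteq> sets coins"
        by (auto intro: sets.Int[OF B] sets_determined[OF determined_core])
      show "incseq (\<lambda>L. B \<inter> core L X)"
        using incseq_core[of X] unfolding incseq_def by blast
    qed
    moreover have "(\<Union>L. B \<inter> core L X) = B \<inter> X"
      using UN_core[OF X] by blast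
    ultimately show "(\<lambda>L. measure coins (B \<inter> core L X)) \<longlonglongrightarrow> measure coins (B \<inter> X)"
      by (simp only:)
    have "(\<lambda>L. measure coins (core L X)) \<longlonglongrightarrow> measure coins (\<Union>L. core L X)"
      by (rule coins.P.finite_Lim_measure_incseq[OF _ incseq_core])
        (auto intro: sets_determined[OF determined_core])
    then show "(\<lambda>L. c * measure coins (core L X)) \<longlonglongrightarrow> c * measure coins X"
      unfolding UN_core[OF X] by (rule tendsto_mult_left)
    show "\<exists>N. \<forall>n\<ge>N. measure coins (B \<inter> core n X) \<le> c * measure coins (core n X)"
      using det[OF determined_core] by blast
  qed
  define V where "V n = (\<Inter>i\<le>n. U i)" for n
  have V: "finitely_confirmed (V n)" for n
    unfolding V_def by (intro finitely_confirmed_INT U) simp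
  have BV: "(\<Inter>n. V n) = B" by (auto simp: V_def B_def)
  have "(\<lambda>n. measure coins (V n)) \<longlonglongrightarrow> measure coins (\<Inter>n. V n)"
  proof (rule coins.P.finite_Lim_measure_decseq)
    show "range V \<subseteq> sets coins" by (auto intro: sets_finitely_confirmed[OF V])
    show "decseq V" by (rule decseq_SucI) (auto simp: V_def)
  qed
  then have "(\<lambda>n. c * measure coins (V n)) \<longlonglongrightarrow> c * measure coins B"
    unfolding BV by (rule tendsto_mult_left)
  moreover have "measure coins B \<le> c * measure coins (V n)" for n
  proof -
    have "B \<inter> V n = B" using BV by blast
    then show ?thesis using conf[OF V, of n] by (simp only:)
  qed
  ultimately have "measure coins B \<le> c * measure coins B"
    by (intro LIMSEQ_le_const) auto
  also have "\<dots> < 1 * measure coins B"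
    using c pos by (rule mult_strict_right_mono)
  finally show False by simp
qed

section \<open>Unpredictability of the permuted bits\<close>

text \<open>
  The oracle \<open>w\<close> plays the role of \<open>y \<oplus> r\<close>, so that \<open>w (2 * s)\<close> is \<open>y s\<close>, the bit that an
  inverter has to answer on input \<open>source s\<close>. Inputs outside the range of \<open>source\<close> only
  require the machine to halt.
\<close>

definition guessed :: "nat \<Rightarrow> nat \<Rightarrow> bitseq set" where
  "guessed c n = {w. \<exists>t. halted c w t n \<and>
     (\<forall>s. source s = n \<longrightarrow> pfst (run c w t n) = of_bool (w (2 * s)))}"

lemma finitely_confirmed_guessed: "finitely_confirmed (guessed c n)"
proof -
  obtain L where L: "\<And>s. source s = n \<Longrightarrow> 2 * s < L"
  proof (cases "\<exists>s. source s = n")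
    case True
    then obtain s where s: "source s = n" by blast
    have "s' = s" if "source s' = n" for s'
      using s that injD[OF inj_source, of s' s] by simp
    then show ?thesis by (intro that[of "Suc (2 * s)"]) simp
  qed (use that in blast)
  show ?thesis
    unfolding finitely_confirmed_def
  proof
    fix w assume "w \<in> guessed c n"
    then obtain t where t: "halted c w t n"
      "\<And>s. source s = n \<Longrightarrow> pfst (run c w t n) = of_bool (w (2 * s))"
      by (auto simp: guessed_def)
    have "w' \<in> guessed c n" if w': "\<forall>i<max t L. w' i = w i" for w'
    proof -
      have "run c w' t n = run c w t n"
        using w' by (intro run_extend[OF t(1)]) auto
      moreover have "w' (2 * s) = w (2 * s)" if "source s = n" for s
        using w' L[OF that] by simp
      ultimately have "halted c w' t n \<and>
          (\<forall>s. source s = n \<longrightarrow> pfst (run c w' t n) = of_bool (w' (2 * s)))"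
        using t by (simp add: halted_def)
      then show ?thesis unfolding guessed_def by blast
    qed
    then show "\<exists>L. \<forall>y. (\<forall>i<L. y i = w i) \<longrightarrow> y \<in> guessed c n" by blast
  qed
qed

lemma determined_halted: "L \<le> t \<Longrightarrow> determined t (cylinder L a \<inter> {w. halted c w t n})"
  unfolding determined_def
proof (intro allI impI)
  fix x y assume L: "L \<le> t" and xy: "\<forall>i<t. x i = y i" and x: "x \<in> cylinder L a \<inter> {w. halted c w t n}"
  then have "run c y t n = run c x t n" by (intro run_extend) auto
  then show "y \<in> cylinder L a \<inter> {w. halted c w t n}"
    using L xy x by (auto simp: halted_def cylinder_def)
qed

lemma trigger_iff:
  "trigger (pair c (pair L a)) t \<longleftrightarrow> L \<le> t \<and>
     3/4 * (1/2) ^ L < measure coins (cylinder L a \<inter> {w. halted c w t (2 * pair c (pair L a) + 1)})"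
proof (cases "L \<le> t")
  case True
  define n where "n = 2 * pair c (pair L a) + 1"
  define N where "N = card {b :: nat. b < 2 ^ t \<and> bit b \<in> cylinder L a \<inter> {w. halted c w t n}}"
  have N: "(\<Sum>b<(2::nat) ^ t. of_bool ((\<forall>i<L. bit b i \<longleftrightarrow> bit a i) \<and> halted c (bit b) t n)) = N"
    by (simp add: N_def cylinder_def lessThan_def Collect_conj_eq Int_assoc)
  have "trigger (pair c (pair L a)) t \<longleftrightarrow> 3 * 2 ^ t < 4 * 2 ^ L * N"
    using True
    by (simp only: trigger_def prod_encode_inverse fst_conv snd_conv n_def[symmetric] N simp_thms)
  also have "\<dots> \<longleftrightarrow> 3 * 2 ^ t < 4 * 2 ^ L * real N"
    by (metis (mono_tags, lifting) of_nat_less_iff of_nat_mult of_nat_numeral of_nat_power)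
  also have "\<dots> \<longleftrightarrow> 3/4 * (1/2) ^ L < real N / 2 ^ t"
    by (simp add: power_one_over field_simps)
  also have "real N / 2 ^ t = measure coins (cylinder L a \<inter> {w. halted c w t n})"
    unfolding N_def by (rule measure_determined[symmetric, OF determined_halted[OF True]])
  finally show ?thesis using True by (simp add: n_def)
qed (simp add: trigger_def)

text \<open>
  Flipping bit \<open>k\<close> preserves the measure and maps \<open>X\<close> to a disjoint subset of \<open>D\<close>.
\<close>

lemma measure_predict_bit_le:
  assumes D: "D \<in> sets coins" "\<And>w. w \<in> D \<Longrightarrow> w(k := \<not> w k) \<in> D"
    and X: "X \<in> sets coins" "X \<subseteq> D"
    and no_flip: "\<And>w. w \<in> X \<Longrightarrow> w(k := \<not> w k) \<notin> X"
  shows "2 * measure coins X \<le> measure coins D"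
proof -
  let ?Y = "{w. w(k := \<not> w k) \<in> X}"
  have flip2: "(w(k := \<not> w k))(k := \<not> (w(k := \<not> w k)) k) = w" for w :: bitseq
    by auto
  have "?Y \<in> sets coins"
  proof -
    have "(\<lambda>w :: bitseq. w(k := \<not> w k)) \<in> coins \<rightarrow>\<^sub>M coins"
      by (rule measurable_flip)
    from measurable_sets[OF this X(1)] show ?thesis by (simp add: vimage_def)
  qed
  have "?Y \<subseteq> D"
  proof
    fix w assume "w \<in> ?Y"
    then have "w(k := \<not> w k) \<in> D" using X(2) by blast
    from D(2)[OF this] show "w \<in> D" by (simp only: flip2)
  qed
  have "2 * measure coins X = measure coins X + measure coins ?Y"
    using measure_coins_flip[OF X(1), of k] by simp
  also have "\<dots> = measure coins (X \<union> ?Y)"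
    using X \<open>?Y \<in> sets coins\<close> no_flip by (intro coins.P.finite_measure_Union[symmetric]) auto
  also have "\<dots> \<le> measure coins D"
    using X \<open>?Y \<subseteq> D\<close> D by (intro coins.P.finite_measure_mono) auto
  finally show ?thesis .
qed

text \<open>
  Almost no oracle lets a fixed program answer every input correctly. Suppose otherwise, and
  take a cylinder in which the set \<open>B\<close> of good oracles has density above \<open>3/4\<close>. On all of \<open>B\<close> the
  machine halts, so the pair \<open>e\<close> of program and cylinder triggers at a first time \<open>t\<close>, and then
  the reserved number is \<open>source s\<close> with \<open>s = pair e t\<close>. The set \<open>D t\<close> of oracles
  in the cylinder on which the machine has halted by time \<open>t\<close> has density \<open>d > 3/4\<close> there. The answer
  does not depend on bit \<open>2 * s\<close>, but has to be equal to it, so \<open>B\<close> contains at most half of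
  \<open>D t\<close>. Therefore the density of \<open>B\<close> is at most \<open>d / 2 + (1 - d) < 5/8\<close>.
\<close>

lemma measure_guessed: "measure coins (\<Inter>n. guessed c n) = 0"
proof (rule ccontr)
  let ?B = "\<Inter>n. guessed c n"
  assume "measure coins ?B \<noteq> 0"
  then have "measure coins ?B > 0" by (simp add: zero_less_measure_iff)
  then obtain L a where dense: "measure coins (?B \<inter> cylinder L a) > 3/4 * (1/2) ^ L"
    using exists_dense_cylinder[of "guessed c" "3/4"] finitely_confirmed_guessed by auto
  define e where "e = pair c (pair L a)"
  define n where "n = 2 * e + 1"
  define D where "D t = cylinder L a \<inter> {w. halted c w t n}" for t
  have B: "?B \<in> sets coins"
    using sets_finitely_confirmed[OF finitely_confirmed_guessed]
    by (intro sets.countable_INT) auto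
  \<comment> \<open>The time is shifted by \<open>L\<close> because \<open>e\<close> cannot trigger before the prefix has been read.\<close>
  have D: "determined (t + L) (D (t + L))" for t
    unfolding D_def by (rule determined_halted) simp
  have "\<exists>t. trigger e t"
  proof (rule ccontr)
    assume "\<not> ?thesis"
    then have small: "measure coins (D (t + L)) \<le> 3/4 * (1/2) ^ L" for t
      unfolding e_def trigger_iff D_def n_def by (auto simp: not_less)
    have "incseq (\<lambda>t. D (t + L))"
    proof (rule incseq_SucI)
      have "halted c w (Suc t) n" if "halted c w t n" for w t
        using that run_extend[OF that, of "Suc t" w] by (simp add: halted_def)
      then show "D (t + L) \<subseteq> D (Suc t + L)" for t by (auto simp: D_def)
    qed
    then have "(\<lambda>t. measure coins (D (t + L))) \<longlonglongrightarrow> measure coins (\<Union>t. D (t + L))"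
      using sets_determined[OF D] by (intro coins.P.finite_Lim_measure_incseq) auto
    then have "measure coins (\<Union>t. D (t + L)) \<le> 3/4 * (1/2) ^ L"
      using small by (intro LIMSEQ_le_const2) auto
    moreover have "?B \<inter> cylinder L a \<subseteq> (\<Union>t. D (t + L))"
    proof
      fix w assume w: "w \<in> ?B \<inter> cylinder L a"
      then obtain t where t: "halted c w t n" by (auto simp: guessed_def)
      then have "halted c w (t + L) n"
        using run_extend[OF t, of "t + L" w] by (simp add: halted_def)
      then show "w \<in> (\<Union>t. D (t + L))" using w by (auto simp: D_def)
    qed
    then have "measure coins (?B \<inter> cylinder L a) \<le> measure coins (\<Union>t. D (t + L))"
      using sets_determined[OF D] by (intro coins.P.finite_measure_mono) auto
    ultimately show False using dense by linarith
  qed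
  define t where "t = (LEAST t. trigger e t)"
  have t: "trigger e t" "\<And>t'. t' < t \<Longrightarrow> \<not> trigger e t'"
    unfolding t_def using \<open>\<exists>t. trigger e t\<close> by (auto intro: LeastI_ex dest: not_less_Least)
  define s where "s = pair e t"
  have source_s: "source s = n"
    using t by (simp add: source_def s_def n_def)
  \<comment> \<open>Bit \<open>2 * s\<close> is not among the first \<open>t\<close> bits.\<close>
  have ts: "t \<le> 2 * s" using le_prod_encode_2[of t e] by (simp add: s_def)
  from t(1) have Lt: "L \<le> t" and big: "3/4 * (1/2) ^ L < measure coins (D t)"
    unfolding e_def trigger_iff D_def n_def by auto
  have Dt: "determined t (D t)" unfolding D_def by (rule determined_halted[OF Lt])
  note sets_Dt = sets_determined[OF Dt]
  have "2 * measure coins (?B \<inter> D t) \<le> measure coins (D t)"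
  proof (rule measure_predict_bit_le[where k = "2 * s"])
    show "w(2 * s := \<not> w (2 * s)) \<in> D t" if "w \<in> D t" for w
      by (rule Dt[unfolded determined_def, rule_format, OF _ that]) (use ts in auto)
    show "w(2 * s := \<not> w (2 * s)) \<notin> ?B \<inter> D t" if w: "w \<in> ?B \<inter> D t" for w
    proof
      let ?w = "w(2 * s := \<not> w (2 * s))"
      assume w': "?w \<in> ?B \<inter> D t"
      \<comment> \<open>The time at which an oracle in \<open>B\<close> is known to halt may differ from \<open>t\<close>, but not the value.\<close>
      have forced: "pfst (run c v t n) = of_bool (v (2 * s))" if v: "v \<in> ?B \<inter> D t" for v
      proof -
        from v obtain t' where t': "halted c v t' n" "pfst (run c v t' n) = of_bool (v (2 * s))"
          using source_s by (auto simp: guessed_def)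
        moreover have "halted c v t n" using v by (simp add: D_def)
        ultimately have "run c v t' n = run c v t n"
          by (metis nat_le_linear run_extend)
        then show ?thesis using t'(2) by simp
      qed
      have "run c ?w t n = run c w t n"
        using w ts by (intro run_extend) (auto simp: D_def)
      then show False
        using forced[OF w] forced[OF w'] by (cases "w (2 * s)") simp_all
    qed
  qed (use B sets_Dt in auto)
  moreover have "measure coins (?B \<inter> cylinder L a) \<le>
      measure coins (?B \<inter> D t) + measure coins (cylinder L a - D t)"
  proof -
    have sets: "?B \<inter> D t \<in> sets coins" "cylinder L a - D t \<in> sets coins"
      using B sets_Dt sets_cylinder by blast+
    have "measure coins (?B \<inter> cylinder L a) \<le> measure coins (?B \<inter> D t \<union> (cylinder L a - D t))"
      by (rule coins.P.finite_measure_mono[OF _ sets.Un[OF sets]]) blast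
    also have "\<dots> \<le> measure coins (?B \<inter> D t) + measure coins (cylinder L a - D t)"
      by (rule measure_Un_le[OF sets])
    finally show ?thesis .
  qed
  moreover have "measure coins (cylinder L a - D t) = (1/2) ^ L - measure coins (D t)"
    using coins.P.finite_measure_Diff[OF sets_cylinder sets_Dt, of L a]
    by (simp add: measure_cylinder D_def)
  moreover have "(1/2 :: real) ^ L > 0" by simp
  ultimately show False using dense big by linarith
qed

section \<open>Partial computable functions and uniformly c.e. sets\<close>

lemma computable_n_pair:
  assumes "computable F"
  shows "computable_n 2 (\<lambda>A xs. F A (pair (xs ! 0) (xs ! 1)))"
proof -
  have "computable_n 2 (\<lambda>A xs. pair (xs ! 0) (xs ! 1))"
    by (intro computable_n_op2[OF computable2_prod_encode] computable_n_nth) auto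
  with computable_n_comp[of "[\<lambda>A xs. pair (xs ! 0) (xs ! 1)]" "\<lambda>A xs. F A (xs ! 0)" 2] assms
  show ?thesis unfolding computable_def by simp
qed

text \<open>
  Composition is strict, so the arguments have to be evaluated; by determinism their values are the
  given ones.
\<close>

lemma halts_Comp:
  assumes "list_all2 (\<lambda>g u. eval A g xs u) gs us"
  shows "halts A (Comp f gs) xs \<longleftrightarrow> halts A f us"
proof
  assume "halts A (Comp f gs) xs"
  then obtain v where "eval A (Comp f gs) xs v" unfolding halts_def by blast
  then obtain us' where us': "list_all2 (\<lambda>g u. eval A g xs u) gs us'" "eval A f us' v"
    by (rule eval_CompE)
  have "us = us'"
  proof (rule nth_equalityI)
    show "length us = length us'"
      using list_all2_lengthD[OF assms] list_all2_lengthD[OF us'(1)] by simp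
    fix i assume "i < length us"
    then have i: "i < length gs" using list_all2_lengthD[OF assms] by simp
    show "us ! i = us' ! i"
      by (rule eval_deterministic[OF list_all2_nthD[OF assms i] list_all2_nthD[OF us'(1) i]])
  qed
  with us'(2) show "halts A f us" unfolding halts_def by blast
qed (use assms in \<open>auto simp: halts_def intro: eval.Comp\<close>)

text \<open>
  Minimisation over a variable that the function ignores halts at once or not at all.
\<close>

lemma computable_n_semidecides:
  assumes "computable_n k G"
  obtains p where "\<And>A xs. length xs = k \<Longrightarrow> halts A p xs \<longleftrightarrow> G A xs = 0"
proof -
  have "computable_n (Suc k) (\<lambda>A ys. G A (map (\<lambda>H. H A ys) (map (\<lambda>i (_ :: bitseq) ys. ys ! Suc i) [0..<k])))"
    by (rule computable_n_comp) (use assms in \<open>auto intro: computable_n_nth\<close>)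
  then have "computable_n (Suc k) (\<lambda>A ys. G A (tl ys))"
    by (rule computable_n_cong) (auto intro!: arg_cong[of _ _ "G _"] nth_equalityI simp: nth_tl)
  then obtain q where q: "\<And>A ys. length ys = Suc k \<Longrightarrow> eval A q ys (G A (tl ys))"
    unfolding computable_n_def by blast
  have "halts A (Mu q) xs \<longleftrightarrow> G A xs = 0" if "length xs = k" for A xs
  proof
    assume "halts A (Mu q) xs"
    then obtain m where "eval A (Mu q) xs m" unfolding halts_def by blast
    then have "eval A q (m # xs) 0" by (rule eval_MuE)
    with q[of "m # xs" A] that show "G A xs = 0" by (auto dest: eval_deterministic)
  next
    assume "G A xs = 0"
    with q[of "0 # xs" A] that have "eval A (Mu q) xs 0" by (auto intro!: eval.Mu)
    then show "halts A (Mu q) xs" unfolding halts_def by blast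
  qed
  then show ?thesis by (rule that)
qed

text \<open>
  The program evaluates \<open>F\<close> and, as a second argument of a projection, a program that
  diverges unless \<open>G A n = 0\<close>.
\<close>

lemma partial_computableI:
  assumes F: "computable F" and G: "computable G"
    and f: "\<And>A. f A = (if \<forall>n. G A n = 0 then Some (y A) else None)"
    and y: "\<And>A n. F A n = of_bool (y A n)"
  shows "partial_computable f"
proof -
  obtain p where p: "\<And>A n. eval A p [n] (F A n)" using F by (rule computableE) blast
  obtain q where q: "\<And>A n. halts A q [n] \<longleftrightarrow> G A n = 0"
    using computable_n_semidecides[OF G[unfolded computable_def]]
    by (metis One_nat_def length_Cons list.size(3) nth_Cons_0)
  let ?r = "Comp (Proj 0) [p, q]"
  have r: "eval A ?r [n] (F A n)" if "G A n = 0" for A n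
  proof -
    from that q obtain u where "eval A q [n] u" unfolding halts_def by blast
    then show ?thesis
      using p eval.Comp[of A "[n]" "[p, q]" "[F A n, u]"] eval.Proj[of 0 "[F A n, u]" A] by simp
  qed
  have "G A n = 0" if "halts A ?r [n]" for A n
  proof -
    from that obtain v where "eval A ?r [n] v" unfolding halts_def by blast
    then obtain us where "list_all2 (\<lambda>g u. eval A g [n] u) [p, q] us" by (rule eval_CompE)
    then show ?thesis using q unfolding halts_def by (auto simp: list_all2_Cons1)
  qed
  with r have "halts A ?r [n] \<longleftrightarrow> G A n = 0" for A n unfolding halts_def by blast
  with r have "computes ?r f"
    unfolding computes_def by (auto simp: f dom_def y split: if_splits)
  then show ?thesis unfolding partial_computable_def by blast
qed

lemma uniformly_ceI:
  assumes "computable (\<lambda>A x. of_bool (P A (pfst x) (psnd x)))"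
    and "\<And>n \<sigma>. \<sigma> \<in> W n \<longleftrightarrow> P (\<lambda>_. False) n (list_encode (map of_bool \<sigma>))"
  shows "uniformly_ce W"
proof -
  have "computable (\<lambda>A x. of_bool (\<not> P A (pfst x) (psnd x)))"
    by (intro computable_intros assms)
  from computable_n_semidecides[OF computable_n_pair[OF this]] obtain p
    where p: "\<And>A xs. length xs = 2 \<Longrightarrow> halts A p xs \<longleftrightarrow> of_bool (\<not> P A (xs ! 0) (xs ! 1)) = (0 :: nat)"
    by (auto simp only: prod_encode_inverse fst_conv snd_conv)
  have "halts A p [n, c] \<longleftrightarrow> P A n c" for A n c
    using p[of "[n, c]" A] by simp
  then show ?thesis
    unfolding uniformly_ce_def by (intro exI[of _ p]) (simp add: assms(2))
qed

text \<open>
  For a c.e. set the preimage under a map on strings that is computed by \<open>r\<close> on codes needs no search: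
  the program for \<open>W\<close> is composed with \<open>r\<close>.
\<close>

lemma uniformly_ce_vimage:
  assumes W: "uniformly_ce W" and r: "computable r"
    and f: "\<And>\<sigma>. r (\<lambda>_. False) (list_encode (map of_bool \<sigma>)) = list_encode (map of_bool (f \<sigma>))"
  shows "uniformly_ce (\<lambda>n. {\<sigma>. f \<sigma> \<in> W n})"
proof -
  obtain p where p: "\<And>n \<sigma>. \<sigma> \<in> W n \<longleftrightarrow> halts (\<lambda>_. False) p [n, list_encode (map of_bool \<sigma>)]"
    using W unfolding uniformly_ce_def by blast
  obtain q where q: "\<And>A x. eval A q [x] (r A x)" using r by (rule computableE) blast
  have "eval A (Comp q [Proj 1]) [n, c] (r A c)" for A n c
    using q eval.Comp[of A "[n, c]" "[Proj 1]" "[c]"] eval.Proj[of 1 "[n, c]" A] by simp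
  moreover have "eval A (Proj 0) [n, c] n" for A n c
    using eval.Proj[of 0 "[n, c]" A] by simp
  ultimately have comp: "halts A (Comp p [Proj 0, Comp q [Proj 1]]) [n, c] \<longleftrightarrow> halts A p [n, r A c]"
    for A n c
    by (intro halts_Comp) simp
  show ?thesis unfolding uniformly_ce_def
  proof (intro exI allI)
    fix n \<sigma>
    show "\<sigma> \<in> {\<sigma>. f \<sigma> \<in> W n} \<longleftrightarrow>
        halts (\<lambda>_. False) (Comp p [Proj 0, Comp q [Proj 1]]) [n, list_encode (map of_bool \<sigma>)]"
      unfolding mem_Collect_eq comp f by (rule p)
  qed
qed

section \<open>Evaluating the completed measure\<close>

lemma measure_cantor: "X \<in> sets coins \<Longrightarrow> measure cantor_measure X = measure coins X"
  unfolding cantor_measure_def by (rule measure_completion)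

lemma measure_cantor_null:
  assumes "X \<subseteq> N" "N \<in> sets coins" "measure coins N = 0"
  shows "measure cantor_measure X = 0"
proof -
  have "N \<in> null_sets coins"
    by (rule null_setsI) (simp_all only: assms coins.P.emeasure_eq_measure ennreal_0)
  then have "X \<in> null_sets cantor_measure"
    unfolding cantor_measure_def null_sets_completion_iff2 using assms(1) by blast
  then show ?thesis by (rule measure_eq_0_null_sets)
qed

lemma coins_bit:
  shows sets_coins_bit: "{x. x i} \<in> sets coins"
    and sets_coins_not_bit: "{x. \<not> x i} \<in> sets coins"
    and measure_coins_bit: "measure coins {x. x i} = 1/2"
    and measure_coins_not_bit: "measure coins {x. \<not> x i} = 1/2"
proof -
  have *: "{x. x i} = {x. \<forall>j\<in>{i}. x j = True}" "{x. \<not> x i} = {x. \<forall>j\<in>{i}. x j = False}"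
    by auto
  show "{x. x i} \<in> sets coins" "{x. \<not> x i} \<in> sets coins"
    unfolding * by (rule sets_coins_cylinder, simp)+
  have "measure coins {x. \<forall>j\<in>{i}. x j = b} = 1/2" for b
    by (subst measure_coins_cylinder) simp_all
  then show "measure coins {x. x i} = 1/2" "measure coins {x. \<not> x i} = 1/2"
    unfolding * by blast+
qed

lemma sets_coins_all:
  fixes h :: "nat \<Rightarrow> nat"
  shows "{x. \<forall>n. x (h n)} \<in> sets coins"
proof -
  have "(\<Inter>n. {x :: bitseq. x (h n)}) \<in> sets coins"
    by (rule sets.countable_INT) (auto intro: sets_coins_bit)
  moreover have "(\<Inter>n. {x :: bitseq. x (h n)}) = {x. \<forall>n. x (h n)}" by blast
  ultimately show ?thesis by (simp only:)
qed

text \<open>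
  Injectivity makes the \<open>n\<close> conditions independent.
\<close>

lemma measure_all_less:
  fixes h :: "nat \<Rightarrow> nat"
  assumes "inj h"
  shows "{x. \<forall>i<n. x (h i)} \<in> sets coins" "measure coins {x. \<forall>i<n. x (h i)} = (1/2) ^ n"
proof -
  have eq: "{x. \<forall>i<n. x (h i)} = {x. \<forall>j\<in>h ` {..<n}. x j = True}" by auto
  show "{x. \<forall>i<n. x (h i)} \<in> sets coins"
    unfolding eq by (rule sets_coins_cylinder) simp
  have "card (h ` {..<n}) = n"
    using card_image[of h "{..<n}"] inj_on_subset[OF assms] by simp
  then show "measure coins {x. \<forall>i<n. x (h i)} = (1/2) ^ n"
    unfolding eq by (subst measure_coins_cylinder) auto
qed

lemma measure_all:
  fixes h :: "nat \<Rightarrow> nat"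
  assumes "inj h"
  shows "measure coins {x. \<forall>n. x (h n)} = 0"
proof -
  have "measure coins {x. \<forall>n. x (h n)} \<le> (1/2) ^ k" for k
    using coins.P.finite_measure_mono[OF _ measure_all_less(1)[OF assms], of "{x. \<forall>n. x (h n)}" k]
    by (auto simp: measure_all_less(2)[OF assms])
  moreover have "(\<lambda>k. (1/2 :: real) ^ k) \<longlonglongrightarrow> 0" by (rule LIMSEQ_realpow_zero) auto
  ultimately have "measure coins {x. \<forall>n. x (h n)} \<le> 0"
    by (intro LIMSEQ_le_const) auto
  then show ?thesis by (simp add: measure_le_0_iff)
qed

lemma join_even [simp]: "(x \<oplus> y) (2 * n) = x n"
  by (simp add: join_def)

lemma join_parts: "w = (\<lambda>n. w (2 * n)) \<oplus> (\<lambda>n. w (Suc (2 * n)))"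
proof
  show "w k = ((\<lambda>n. w (2 * n)) \<oplus> (\<lambda>n. w (Suc (2 * n)))) k" for k
    by (cases "even k") (simp_all add: join_def)
qed

section \<open>The oneway function\<close>

text \<open>
  Both branches keep the first bit, the second because \<open>source 0 = 0\<close>. So a preimage of
  \<open>scramble x\<close> is in the same branch as \<open>x\<close>.
\<close>

definition scramble :: "bitseq \<rightharpoonup> bitseq" where
  "scramble x =
     (if x 0 then if \<forall>n. x (2 * n + 1) then Some (\<lambda>n. x (2 * n)) else None
      else Some (\<lambda>n. x (source n)))"

lemma scramble_cases:
  assumes "scramble x = Some y"
  obtains (copy) "x 0" "\<forall>n. x (2 * n + 1)" "y = (\<lambda>n. x (2 * n))"
    | (pull) "\<not> x 0" "y = (\<lambda>n. x (source n))"
proof (cases "x 0")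
  case True
  show ?thesis
  proof (cases "\<forall>n. x (2 * n + 1)")
    case odd: True
    have "scramble x = Some (\<lambda>n. x (2 * n))"
      unfolding scramble_def if_P[OF True] if_P[OF odd] by (rule refl)
    then show ?thesis using assms by (intro copy True odd) simp
  next
    case False
    then show ?thesis using assms by (simp only: scramble_def True if_True if_False option.distinct)
  qed
next
  case False
  then show ?thesis
    using assms by (intro pull) (simp_all only: scramble_def if_False option.inject not_False_eq_True)
qed

lemma partial_computable_scramble: "partial_computable scramble"
proof (rule partial_computableI)
  show "computable (\<lambda>A n. of_bool (A (if A 0 then 2 * n else source n)))"
    by (intro computable_intros)
  show "computable (\<lambda>A n. of_bool (A 0 \<and> \<not> A (2 * n + 1)))"
    by (intro computable_intros)
  show "scramble A = (if \<forall>n. of_bool (A 0 \<and> \<not> A (2 * n + 1)) = (0::nat)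
      then Some (\<lambda>n. A (if A 0 then 2 * n else source n)) else None)" for A
    by (auto simp: scramble_def)
qed simp

lemma dom_scramble: "dom scramble = {x. \<not> x 0} \<union> ({x. x 0} \<inter> {x. \<forall>n. x (2 * n + 1)})"
  by (auto simp: scramble_def dom_def split: if_splits)

lemma measure_dom_scramble: "measure cantor_measure (dom scramble) > 0"
proof -
  have dom: "dom scramble \<in> sets coins"
    unfolding dom_scramble
    by (intro sets.Un sets.Int sets_coins_bit sets_coins_not_bit sets_coins_all)
  have "measure coins {x. \<not> x 0} \<le> measure coins (dom scramble)"
    by (rule coins.P.finite_measure_mono[OF _ dom]) (simp add: dom_scramble)
  then have "0 < measure coins (dom scramble)" by (simp only: measure_coins_not_bit)
  then show ?thesis by (simp only: measure_cantor[OF dom])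
qed

lemma finitely_confirmed_cylinders: "finitely_confirmed (cylinders S)"
  unfolding finitely_confirmed_def
proof
  fix x assume "x \<in> cylinders S"
  then obtain \<sigma> where "\<sigma> \<in> S" "\<forall>i<length \<sigma>. x i = \<sigma> ! i" by (auto simp: cylinders_def)
  then have "y \<in> cylinders S" if "\<forall>i<length \<sigma>. y i = x i" for y
    unfolding cylinders_def using that by (intro CollectI bexI[of _ \<sigma>]) simp_all
  then show "\<exists>L. \<forall>y. (\<forall>i<L. y i = x i) \<longrightarrow> y \<in> cylinders S" by blast
qed

text \<open>
  A real with all odd bits \<open>True\<close> is captured by the test that asks for the first \<open>n\<close> of them.
\<close>

lemma not_ml_random_odd:
  assumes "\<forall>n. x (2 * n + 1)"
  shows "\<not> ml_random x"
proof -
  define W where "W n = {\<sigma>. \<forall>i<n. 2 * i + 1 < length \<sigma> \<and> \<sigma> ! (2 * i + 1)}" for n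
  have cyl: "cylinders (W n) = {x. \<forall>i<n. x (2 * i + 1)}" for n
  proof (intro equalityI subsetI)
    fix x assume "x \<in> {x. \<forall>i<n. x (2 * i + 1)}"
    then have "map x [0..<2 * n] \<in> W n" by (auto simp: W_def)
    then show "x \<in> cylinders (W n)"
      unfolding cylinders_def by (intro CollectI bexI[of _ "map x [0..<2 * n]"]) auto
  qed (auto simp: cylinders_def W_def)
  have inj: "inj (\<lambda>i :: nat. 2 * i + 1)" by (auto intro: injI)
  have "uniformly_ce W"
  proof (rule uniformly_ceI)
    \<comment> \<open>Beyond the end of the string \<open>nth_code\<close> is \<open>0\<close>, so the value \<open>1\<close> also tests the length.\<close>
    show "computable (\<lambda>A x. of_bool ((\<lambda>_ n c. \<forall>i<n. nth_code c (2 * i + 1) = 1) A (pfst x) (psnd x)))"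
      by (intro computable_intros)
    show "\<sigma> \<in> W n \<longleftrightarrow> (\<forall>i<n. nth_code (list_encode (map of_bool \<sigma>)) (2 * i + 1) = 1)" for n \<sigma>
      by (auto simp: W_def nth_code_list_encode split: if_splits)
  qed
  then have "ml_test W"
    unfolding ml_test_def cyl using measure_all_less[OF inj] by (simp add: measure_cantor)
  moreover have "x \<in> (\<Inter>n. cylinders (W n))" using assms by (simp add: cyl)
  ultimately show ?thesis unfolding ml_random_def by blast
qed

text \<open>
  The bits of \<open>scramble x\<close> that can be read off the prefix \<open>\<sigma>\<close> of \<open>x\<close>. By \<open>source_le\<close> a prefix of
  length \<open>2 * k\<close> suffices for \<open>k\<close> bits.
\<close>

definition pull :: "bool list \<Rightarrow> bool list" where
  "pull \<sigma> = map (\<lambda>i. \<sigma> ! source i) [0..<length \<sigma> div 2]"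

definition pull_code :: "nat \<Rightarrow> nat" where
  "pull_code c = rec_nat 0
     (\<lambda>k u. cons_code (nth_code c (source (length_code c div 2 - Suc k))) u) (length_code c div 2)"

lemma computable_pull_code: "computable (\<lambda>_. pull_code)"
  unfolding pull_code_def by (intro computable_intros)

lemma source_less_length: "i < length \<sigma> div 2 \<Longrightarrow> source i < length \<sigma>"
  using source_le[of i] by linarith

lemma pull_code_list_encode:
  "pull_code (list_encode (map of_bool \<sigma>)) = list_encode (map of_bool (pull \<sigma>))"
proof -
  let ?c = "list_encode (map of_bool \<sigma>)" and ?l = "length \<sigma> div 2"
  have "rec_nat 0 (\<lambda>k u. cons_code (nth_code ?c (source (?l - Suc k))) u) k =
      list_encode (map (\<lambda>i. of_bool (\<sigma> ! source i)) [?l - k..<?l])" if "k \<le> ?l" for k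
    using that
  proof (induction k)
    case (Suc k)
    have "[?l - Suc k..<?l] = (?l - Suc k) # [?l - k..<?l]"
      using Suc.prems by (simp add: upt_conv_Cons Suc_diff_Suc)
    then show ?case
      using Suc source_less_length[of "?l - Suc k" \<sigma>] by (simp add: nth_code_list_encode)
  qed simp
  from this[of ?l] show ?thesis
    by (simp add: pull_code_def pull_def length_code_list_encode o_def)
qed

text \<open>
  The strings that \<open>pull\<close> maps into \<open>S\<close> describe exactly the preimage of the open set described by
  \<open>S\<close>: a prefix of length \<open>k\<close> of the image is obtained from the prefix of length \<open>2 * k\<close>.
\<close>

lemma cylinders_pull: "cylinders {\<sigma>. pull \<sigma> \<in> S} = {x. (\<lambda>n. x (source n)) \<in> cylinders S}"
proof (intro equalityI subsetI)
  fix x assume "x \<in> cylinders {\<sigma>. pull \<sigma> \<in> S}"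
  then obtain \<sigma> where \<sigma>: "pull \<sigma> \<in> S" "\<forall>i<length \<sigma>. x i = \<sigma> ! i"
    by (auto simp: cylinders_def)
  then have "\<forall>i<length (pull \<sigma>). x (source i) = pull \<sigma> ! i"
    using source_less_length[of _ \<sigma>] by (simp add: pull_def)
  with \<sigma>(1) show "x \<in> {x. (\<lambda>n. x (source n)) \<in> cylinders S}"
    by (auto simp: cylinders_def)
next
  fix x assume "x \<in> {x. (\<lambda>n. x (source n)) \<in> cylinders S}"
  then obtain \<tau> where \<tau>: "\<tau> \<in> S" "\<forall>i<length \<tau>. x (source i) = \<tau> ! i"
    by (auto simp: cylinders_def)
  let ?\<sigma> = "map x [0..<2 * length \<tau>]"
  have "pull ?\<sigma> = \<tau>"
    using \<tau>(2) source_less_length[of _ ?\<sigma>] by (auto simp: pull_def intro!: nth_equalityI)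
  with \<tau>(1) show "x \<in> cylinders {\<sigma>. pull \<sigma> \<in> S}"
    unfolding cylinders_def by (intro CollectI bexI[of _ ?\<sigma>]) auto
qed

text \<open>
  The preimages of the sets of a test are uniformly c.e., because \<open>pull\<close> is computable, and have the
  same measures, because selecting coins preserves the measure.
\<close>

lemma ml_random_source:
  assumes x: "ml_random x"
  shows "ml_random (\<lambda>n. x (source n))"
  unfolding ml_random_def
proof (intro allI impI)
  fix W assume W: "ml_test W"
  let ?V = "\<lambda>n. {\<sigma>. pull \<sigma> \<in> W n}"
  have V: "measure cantor_measure (cylinders (?V n)) = measure cantor_measure (cylinders (W n))" for n
  proof -
    note sets = sets_finitely_confirmed[OF finitely_confirmed_cylinders]
    have "measure cantor_measure (cylinders (?V n)) = measure coins (cylinders (?V n))"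
      by (rule measure_cantor[OF sets])
    also have "\<dots> = measure coins (cylinders (W n))"
      unfolding cylinders_pull by (rule measure_coins_reindex[OF inj_source sets])
    also have "\<dots> = measure cantor_measure (cylinders (W n))"
      by (rule measure_cantor[OF sets, symmetric])
    finally show ?thesis .
  qed
  have "uniformly_ce W" using W unfolding ml_test_def by (rule conjunct1)
  then have "uniformly_ce ?V"
    by (rule uniformly_ce_vimage[OF _ computable_pull_code pull_code_list_encode])
  then have "ml_test ?V" using W unfolding ml_test_def V by blast
  with x have "x \<notin> (\<Inter>n. cylinders (?V n))" unfolding ml_random_def by blast
  then show "(\<lambda>n. x (source n)) \<notin> (\<Inter>n. cylinders (W n))"
    unfolding cylinders_pull by blast
qed

lemma random_preserving_scramble: "random_preserving scramble"
  unfolding random_preserving_def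
proof (intro conjI allI impI measure_dom_scramble)
  fix x y assume x: "ml_random x" and y: "scramble x = Some y"
  from y show "ml_random y"
  proof (cases rule: scramble_cases)
    case copy
    from not_ml_random_odd[OF copy(2)] x show ?thesis by (rule notE)
  next
    case pull
    show ?thesis unfolding pull(2) by (rule ml_random_source[OF x])
  qed
qed

lemma inverter_guesses:
  assumes p: "computes p g" and z: "g w = Some z" "\<And>s. z (source s) = w (2 * s)"
  shows "w \<in> (\<Inter>n. guessed (code p) n)"
proof
  fix n
  have "eval w p [n] (of_bool (z n))" using p z(1) unfolding computes_def by blast
  from eval_run[OF this] obtain t where t: "run (code p) w t n = pair (of_bool (z n)) 0" by blast
  have "pfst (run (code p) w t n) = of_bool (w (2 * s))" if "source s = n" for s
    using t z(2)[of s] that by simp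
  moreover have "halted (code p) w t n" using t by (simp add: halted_def)
  ultimately show "w \<in> guessed (code p) n" unfolding guessed_def by blast
qed

text \<open>
  Successful pairs \<open>x \<oplus> r\<close> in the copying branch lie in the null set \<open>?odd\<close>. In the other branch
  \<open>(scramble x) \<oplus> r\<close> arises from \<open>x \<oplus> r\<close> by selecting bits along the injection \<open>?h\<close>, and it lies in the
  null set \<open>?B\<close> of oracles on which the inverter answers correctly.
\<close>

lemma left_oneway_scramble: "left_oneway scramble"
  unfolding left_oneway_def
proof (intro conjI allI impI partial_computable_scramble measure_dom_scramble)
  fix g assume "partial_computable g"
  then obtain p where p: "computes p g" unfolding partial_computable_def by blast
  let ?B = "\<Inter>n. guessed (code p) n"
  let ?h = "\<lambda>k. if even k then 2 * source (k div 2) else k"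
  let ?odd = "{w :: bitseq. \<forall>n. w (2 * (2 * n + 1))}"
  let ?N = "?odd \<union> {w. (\<lambda>k. w (?h k)) \<in> ?B}"
  have B: "?B \<in> sets coins"
    by (rule sets.countable_INT) (auto intro: sets_finitely_confirmed finitely_confirmed_guessed)
  have inj: "inj ?h"
  proof (rule injI)
    fix k k' assume eq: "?h k = ?h k'"
    then have "even k \<longleftrightarrow> even k'" by (metis dvd_triv_left)
    then show "k = k'"
      using eq injD[OF inj_source, of "k div 2" "k' div 2"] by (auto split: if_splits elim!: evenE)
  qed
  have "{w. (\<lambda>k. w (?h k)) \<in> ?B} \<in> sets coins"
    using measurable_sets[OF measurable_reindex[of ?h] B] by (simp add: vimage_def)
  moreover have "measure coins {w. (\<lambda>k. w (?h k)) \<in> ?B} = 0"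
    using measure_coins_reindex[OF inj B] measure_guessed by simp
  moreover have "?odd \<in> sets coins" by (rule sets_coins_all)
  moreover have "measure coins ?odd = 0" by (rule measure_all) (auto intro: injI)
  ultimately have N: "?N \<in> sets coins" "measure coins ?N = 0"
    using measure_Un_le[of ?odd coins "{w. (\<lambda>k. w (?h k)) \<in> ?B}"]
    by (auto simp: measure_le_0_iff)
  show "measure cantor_measure
      {x \<oplus> r | x r. \<exists>y z. scramble x = Some y \<and> g (y \<oplus> r) = Some z \<and> scramble z = Some y} = 0"
  proof (rule measure_cantor_null[OF _ N], rule subsetI)
    fix w assume "w \<in> {x \<oplus> r | x r. \<exists>y z. scramble x = Some y \<and> g (y \<oplus> r) = Some z \<and> scramble z = Some y}"
    then obtain x r y z where w: "w = x \<oplus> r" and xy: "scramble x = Some y"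
      and z: "g (y \<oplus> r) = Some z" and zy: "scramble z = Some y" by blast
    from xy show "w \<in> ?N"
    proof (cases rule: scramble_cases)
      case copy
      have "w (2 * (2 * n + 1))" for n
        unfolding w join_even using copy(2) by (rule spec)
      then show ?thesis by blast
    next
      case x: pull
      then have "\<not> y 0" by (simp add: source_0)
      from zy have z_source: "y = (\<lambda>n. z (source n))"
      proof (cases rule: scramble_cases)
        case copy
        with \<open>\<not> y 0\<close> show ?thesis by simp
      qed
      have "(\<lambda>k. w (?h k)) = y \<oplus> r"
        by (auto simp: w x(2) join_def fun_eq_iff)
      moreover have "y \<oplus> r \<in> ?B"
        by (rule inverter_guesses[OF p z]) (simp add: z_source)
      ultimately have "(\<lambda>k. w (?h k)) \<in> ?B" by (simp only:)
      then show ?thesis by blast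
    qed
  qed
qed

text \<open>
  Applied to \<open>y \<oplus> r\<close>, this puts \<open>True\<close> at all odd positions, leaves \<open>y\<close> at the even ones, and sets
  the first bit to \<open>True\<close>. So it succeeds exactly if \<open>y\<close> starts with \<open>True\<close>.
\<close>

definition right_inverse :: "bitseq \<rightharpoonup> bitseq" where
  "right_inverse w = Some (\<lambda>k. \<not> (k \<noteq> 0 \<and> even k \<and> \<not> w k))"

lemma partial_computable_right_inverse: "partial_computable right_inverse"
proof (rule partial_computableI[where y = "\<lambda>A k. \<not> (k \<noteq> 0 \<and> even k \<and> \<not> A k)"])
  show "computable (\<lambda>A k. of_bool (\<not> (\<not> k = 0 \<and> \<not> odd k \<and> \<not> A k)))"
    by (intro computable_intros)
  show "computable (\<lambda>_ _. 0)" by (rule computable_const)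
  show "right_inverse A =
      (if \<forall>n :: nat. (0 :: nat) = 0 then Some (\<lambda>k. \<not> (k \<noteq> 0 \<and> even k \<and> \<not> A k)) else None)" for A
    by (simp add: right_inverse_def)
qed simp

lemma scramble_right_inverse:
  "(\<exists>z. right_inverse (y \<oplus> r) = Some z \<and> scramble z = Some y) \<longleftrightarrow> y 0"
proof -
  define z where "z = (\<lambda>k. \<not> (k \<noteq> 0 \<and> even k \<and> \<not> (y \<oplus> r) k))"
  have z: "z 0" "\<forall>n. z (2 * n + 1)" "\<And>n. z (2 * n) = (n = 0 \<or> y n)"
    by (simp_all add: z_def)
  have "right_inverse (y \<oplus> r) = Some z" by (simp add: right_inverse_def z_def)
  moreover have "scramble z = Some (\<lambda>n. n = 0 \<or> y n)"
    unfolding scramble_def if_P[OF z(1)] if_P[OF z(2)] z(3) by (rule refl)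
  moreover have "(\<lambda>n. n = 0 \<or> y n) = y \<longleftrightarrow> y 0"
  proof
    assume "y 0"
    show "(\<lambda>n. n = 0 \<or> y n) = y"
    proof
      show "(n = 0 \<or> y n) = y n" for n using \<open>y 0\<close> by (cases "n = 0") simp_all
    qed
  qed (drule fun_cong[of _ _ 0], simp)
  ultimately show ?thesis by simp
qed

lemma not_right_oneway_scramble: "\<not> right_oneway scramble"
proof
  assume "right_oneway scramble"
  then have "measure cantor_measure
      {y \<oplus> r | y r. \<exists>z. right_inverse (y \<oplus> r) = Some z \<and> scramble z = Some y} = 0"
    using partial_computable_right_inverse unfolding right_oneway_def by blast
  also have "{y \<oplus> r | y r. \<exists>z. right_inverse (y \<oplus> r) = Some z \<and> scramble z = Some y} = {w. w 0}"
  proof -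
    have "w 0 \<longleftrightarrow> (\<exists>y r. w = y \<oplus> r \<and> y 0)" for w
      using join_parts[of w] join_even[of _ _ 0] by (metis mult_0_right)
    then show ?thesis unfolding scramble_right_inverse by blast
  qed
  also have "measure cantor_measure {w. w 0} = 1/2"
    by (simp only: measure_cantor[OF sets_coins_bit] measure_coins_bit)
  finally show False by simp
qed

theorem theorem3p7:
  "\<exists>f :: bitseq \<rightharpoonup> bitseq.
     partial_computable f \<and> random_preserving f \<and> left_oneway f \<and> \<not> right_oneway f"
  using partial_computable_scramble random_preserving_scramble left_oneway_scramble
    not_right_oneway_scramble by blast

end
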